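(* Let $\boldsymbol{B}\in\mathbb{R}^{n\times n}$ be an index matrix, let $\boldsymbol{g}=(g_1,\ldots,g_n)'\in R_{\boldsymbol{B}}$ and let $f$ be a measurable, real-valued function defined in a neighbourhood of infinity. Then $f\in GRV(\boldsymbol{g})$ with $\boldsymbol{g}$-index $\boldsymbol{c}\in\mathbb{R}^{1\times n}$ if and only if there exist constants $a\in(0,\infty)$ and $v\in\mathbb{R}$ as well as measurable functions $\eta,\phi:[a,\infty)\to\mathbb{R}$, both $o(g_n(t))$ as $t\to\infty$, such that $$f(t)=v+\eta(t)+\int_a^t\{\boldsymbol{c}\,\boldsymbol{g}(u)+\phi(u)\}\,u^{-1}\,\mathrm{d}u,\qquad t\in[a,\infty).$$
   Context: Limit relations are as $t\to\infty$; measurability is Lebesgue. A real function is defined in a neighbourhood of infinity if its domain contains some $[t_0,\infty)$; it is eventually of constant sign if it is either strictly positive for all large $t$ or strictly negative for all large $t$. A rate vector of length $n$ is a column vector $\boldsymbol{g}=(g_1,\ldots,g_n)'$ of real-valued functions defined in a neighbourhood of infinity, each eventually of constant sign, with $g_{i+1}(t)=o(g_i(t))$ for every $i\in\{1,\ldots,n-1\}$; $o(g_n(t))$ means $o(|g_n(t)|)$, componentwise for vectors. For a square matrix $\boldsymbol{B}$ and $x>0$, $x^{\boldsymbol{B}}=\exp\{(\log x)\boldsymbol{B}\}$. An index matrix is an upper triangular $\boldsymbol{B}\in\mathbb{R}^{n\times n}$ whose diagonal elements are non-increasing and all of whose eigenvalues, except possibly the smallest one, have geometric multiplicity one. A rate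 vector $\boldsymbol{g}$ is regularly varying with index matrix $\boldsymbol{B}$, written $\boldsymbol{g}\in R_{\boldsymbol{B}}$, if $\boldsymbol{g}$ is measurable and $\boldsymbol{g}(xt)=x^{\boldsymbol{B}}\boldsymbol{g}(t)+o(g_n(t))$ for every $x\in(0,\infty)$. For $\boldsymbol{g}\in R_{\boldsymbol{B}}$, a measurable real-valued function $f$ defined in a neighbourhood of infinity is generalised regularly varying with rate vector $\boldsymbol{g}$ and $\boldsymbol{g}$-index $\boldsymbol{c}\in\mathbb{R}^{1\times n}$, written $f\in GRV(\boldsymbol{g})$, if for every $x\in(0,\infty)$, $f(xt)=f(t)+\boldsymbol{h}(x)\boldsymbol{g}(t)+o(g_n(t))$ with $\boldsymbol{h}(x)=\boldsymbol{c}\int_1^x y^{\boldsymbol{B}}y^{-1}\,\mathrm{d}y$. In the representation it is understood that the integrals exist. *)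

theory Defs
  imports "HOL-Analysis.Analysis" "HOL-Library.Landau_Symbols"
begin

text \<open>
  The index set of length \<open>n\<close> is a type of sort \<open>{finite, linorder}\<close>, playing the role of
  \<open>1 < \<dots> < n\<close> with \<open>n = CARD('n)\<close>.  A function defined in a neighbourhood of infinity is a total
  function of which only the restriction to some half-line is ever used, so that measurability is
  required on a half-line only.
\<close>

definition last_ix :: "'n::{finite, linorder}" where
  "last_ix = Max UNIV"

definition is_succ :: "'n::{finite, linorder} \<Rightarrow> 'n \<Rightarrow> bool" where
  "is_succ i j \<longleftrightarrow> i < j \<and> {i<..<j} = {}"

definition measurable_near_infinity :: "(real \<Rightarrow> 'a::topological_space) \<Rightarrow> bool" where
  "measurable_near_infinity f \<longleftrightarrow> (\<exists>t0. f \<in> borel_measurable (lebesgue_on {t0..}))"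

definition ev_constant_sign :: "(real \<Rightarrow> real) \<Rightarrow> bool" where
  "ev_constant_sign f \<longleftrightarrow>
     (\<forall>\<^sub>F t in at_top. f t > 0) \<or> (\<forall>\<^sub>F t in at_top. f t < 0)"

definition rate_vector :: "(real \<Rightarrow> real ^ 'n::{finite, linorder}) \<Rightarrow> bool" where
  "rate_vector g \<longleftrightarrow>
     (\<forall>i. ev_constant_sign (\<lambda>t. g t $ i)) \<and>
     (\<forall>i j. is_succ i j \<longrightarrow> (\<lambda>t. g t $ j) \<in> o[at_top](\<lambda>t. g t $ i))"

text \<open>
  Multiplication and powers on \<^typ>\<open>real ^ 'n ^ 'n\<close> coming from the type classes are componentwise;
  the definitions below use the matrix product.
\<close>

definition mat_exp :: "real ^ 'n ^ 'n \<Rightarrow> real ^ 'n ^ 'n" where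
  "mat_exp A = (\<Sum>k. (1 / fact k) *\<^sub>R (((**) A ^^ k) (mat 1)))"

definition mat_powr :: "real \<Rightarrow> real ^ 'n ^ 'n \<Rightarrow> real ^ 'n ^ 'n" where
  "mat_powr x B = mat_exp (ln x *\<^sub>R B)"

definition eigenval :: "real ^ 'n ^ 'n \<Rightarrow> real \<Rightarrow> bool" where
  "eigenval B l \<longleftrightarrow> (\<exists>v. v \<noteq> 0 \<and> B *v v = l *\<^sub>R v)"

definition geometric_multiplicity :: "real ^ 'n ^ 'n \<Rightarrow> real \<Rightarrow> nat" where
  "geometric_multiplicity B l = dim {v. B *v v = l *\<^sub>R v}"

text \<open>
  Real eigenvalues suffice here, since those of a real triangular matrix are its diagonal elements.
\<close>

definition index_matrix :: "real ^ ('n::{finite, linorder}) ^ ('n::{finite, linorder}) \<Rightarrow> bool" where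
  "index_matrix B \<longleftrightarrow>
     (\<forall>i j. j < i \<longrightarrow> B $ i $ j = 0) \<and>
     (\<forall>i j. i \<le> j \<longrightarrow> B $ j $ j \<le> B $ i $ i) \<and>
     (\<forall>l. eigenval B l \<and> (\<exists>m. eigenval B m \<and> m < l) \<longrightarrow> geometric_multiplicity B l = 1)"

definition regularly_varying ::
    "real ^ ('n::{finite, linorder}) ^ ('n::{finite, linorder}) \<Rightarrow> (real \<Rightarrow> real ^ ('n::{finite, linorder})) \<Rightarrow> bool" where
  "regularly_varying B g \<longleftrightarrow>
     rate_vector g \<and> measurable_near_infinity g \<and>
     (\<forall>x>0. \<forall>i. (\<lambda>t. (g (x * t) - mat_powr x B *v g t) $ i) \<in> o[at_top](\<lambda>t. g t $ last_ix))"

text \<open>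
  Row vectors are elements of \<^typ>\<open>real ^ 'n\<close>, multiplied by a matrix from the left by \<open>v*\<close> and with
  a column vector by the inner product.  The integral over \<open>1..x\<close> is oriented: for \<open>x < 1\<close> it is
  minus the integral over \<open>x..1\<close>.
\<close>

definition grv_h :: "real ^ 'n ^ 'n \<Rightarrow> real ^ 'n \<Rightarrow> real \<Rightarrow> real ^ 'n" where
  "grv_h B c x = c v* (LBINT y=1..x. (1 / y) *\<^sub>R mat_powr y B)"

definition GRV ::
    "real ^ ('n::{finite, linorder}) ^ ('n::{finite, linorder}) \<Rightarrow> (real \<Rightarrow> real ^ ('n::{finite, linorder})) \<Rightarrow> real ^ ('n::{finite, linorder}) \<Rightarrow> (real \<Rightarrow> real) \<Rightarrow> bool"
where
  "GRV B g c f \<longleftrightarrow>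
     measurable_near_infinity f \<and>
     (\<forall>x>0. (\<lambda>t. f (x * t) - f t - grv_h B c x \<bullet> g t) \<in> o[at_top](\<lambda>t. g t $ last_ix))"

end

theory Submission
  imports Defs
begin

text \<open>
  For the row \<open>c\<close>, uniform convergence of \<open>g(x t) - x\<^sup>B g(t) = o(g\<^sub>n(t))\<close> on compact sets of
  \<open>x\<close> shows that \<open>I(t) = \<integral> c g(u) / u du\<close> (over \<open>a..t\<close>) satisfies
  \<open>I(x t) - I(t) = h(x) g(t) + o(g\<^sub>n(t))\<close>.  Hence \<open>f\<close> has \<open>g\<close>-index \<open>c\<close> if and only if
  \<open>F = f - I\<close> satisfies \<open>F(x t) - F(t) = o(g\<^sub>n(t))\<close>, which reduces the theorem to \<open>c = 0\<close>.
  Then the average \<open>A(t)\<close> of \<open>F\<close> over \<open>t..2t\<close> with respect to \<open>du / (u ln 2)\<close> differs from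
  \<open>F(t)\<close> by \<open>o(g\<^sub>n(t))\<close>, and \<open>A(t) - A(a)\<close> is the integral of \<open>\<phi>(u) / u\<close> over \<open>a..t\<close> with
  \<open>\<phi>(u) = (F(2u) - F(u)) / ln 2 = o(g\<^sub>n(u))\<close>.
\<close>

section \<open>The matrix exponential\<close>

text \<open>Since \<open>g\<close> and \<open>f\<close> are only measurable, uniformity, local
  boundedness and integrability all have to be earned, and a single measure argument,
  \<open>uniform_convergence_of_cocycle\<close>, is their source. It is applied to the logarithm of
  \<open>g\<^sub>n(x t) / g\<^sub>n(t)\<close>, to the increments of \<open>F\<close>, and to the
  norm of the error vector of \<open>g\<close>. In each of them the value at \<open>x\<close> is
  controlled by the value at \<open>x y\<close> and by the value at \<open>y\<close> started from
  \<open>x t\<close>, with \<open>y\<close> free. The logarithms have to come first: an error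
  measured against \<open>g\<^sub>n(x t)\<close> compares with \<open>g\<^sub>n(t)\<close> only once
  the ratio is bounded uniformly in \<open>x\<close>. The ratio is tractable because the last row of
  \<open>x\<^sup>B\<close> has a single nonzero entry, so the last component of \<open>g\<close>
  varies regularly by itself. The measure du / u is invariant under scaling, which turns increments
  of primitives into integrals over fixed intervals. For the same reason the average
  \<open>A\<close> is, up to a constant, an integral of increments of \<open>F\<close>, although
  \<open>F\<close> itself need not be differentiable.\<close>

lemma bounded_bilinear_matrix_matrix_mult:
  "bounded_bilinear ((**) :: real^'m^'n \<Rightarrow> real^'k^'m \<Rightarrow> real^'k^'n)"
  by (intro bilinear_conv_bounded_bilinear[THEN iffD1])
    (auto simp: bilinear_def linear_iff matrix_matrix_mult_def vec_eq_iff sum.distrib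
      algebra_simps sum_distrib_left)

lemma bounded_bilinear_matrix_vector_mult:
  "bounded_bilinear ((*v) :: real^'m^'n \<Rightarrow> real^'m \<Rightarrow> real^'n)"
  by (intro bilinear_conv_bounded_bilinear[THEN iffD1])
    (auto simp: bilinear_def linear_iff matrix_vector_mult_def vec_eq_iff sum.distrib
      algebra_simps sum_distrib_left)

definition mat_pow :: "real^'n^'n \<Rightarrow> nat \<Rightarrow> real^'n^'n" where
  "mat_pow A k = ((**) A ^^ k) (mat 1)"

lemma mat_pow_simps [simp]: "mat_pow A 0 = mat 1" "mat_pow A (Suc k) = A ** mat_pow A k"
  by (simp_all add: mat_pow_def)

lemma mat_pow_commute: "mat_pow A k ** A = A ** mat_pow A k"
  by (induction k) (simp_all flip: matrix_mul_assoc)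

lemma mat_pow_scaleR: "mat_pow (s *\<^sub>R A) k = s ^ k *\<^sub>R mat_pow A k"
  by (induction k)
    (simp_all add: bounded_bilinear.scaleR_left[OF bounded_bilinear_matrix_matrix_mult]
      bounded_bilinear.scaleR_right[OF bounded_bilinear_matrix_matrix_mult])

text \<open>Bilinearity gives submultiplicativity of the norm up to a constant \<open>K\<close>;
  powers therefore grow at most like \<open>(K * norm A) ^ k\<close>, and a scalar exponential
  series dominates.\<close>

lemma summable_mat_pow:
  fixes A :: "real^'n^'n"
  shows "summable (\<lambda>k. (s ^ k / fact k) *\<^sub>R mat_pow A k)"
proof -
  obtain K where K: "0 \<le> K" "norm (X ** Y) \<le> norm X * norm Y * K" for X Y :: "real^'n^'n"
    using bounded_bilinear.nonneg_bounded[OF bounded_bilinear_matrix_matrix_mult] by metis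
  have pow: "norm (mat_pow A k) \<le> (K * norm A) ^ k * norm (mat 1 :: real^'n^'n)" for k
  proof (induction k)
    case (Suc k)
    have "norm (mat_pow A (Suc k)) \<le> K * norm A * norm (mat_pow A k)"
      using K(2)[of A "mat_pow A k"] by (simp add: mult_ac)
    also have "\<dots> \<le> K * norm A * ((K * norm A) ^ k * norm (mat 1 :: real^'n^'n))"
      using K(1) Suc.IH by (intro mult_left_mono) auto
    finally show ?case by (simp add: mult_ac)
  qed simp
  have "summable (\<lambda>k. norm (mat 1 :: real^'n^'n) * (inverse (fact k) * (\<bar>s\<bar> * (K * norm A)) ^ k))"
    by (intro summable_mult summable_exp)
  then show ?thesis
  proof (rule summable_comparison_test'[where N = 0])
    fix k
    have "norm ((s ^ k / fact k) *\<^sub>R mat_pow A k) = \<bar>s\<bar> ^ k / fact k * norm (mat_pow A k)"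
      by (simp add: power_abs)
    also have "\<dots> \<le> \<bar>s\<bar> ^ k / fact k * ((K * norm A) ^ k * norm (mat 1 :: real^'n^'n))"
      using pow by (intro mult_left_mono) auto
    finally show "norm ((s ^ k / fact k) *\<^sub>R mat_pow A k)
        \<le> norm (mat 1 :: real^'n^'n) * (inverse (fact k) * (\<bar>s\<bar> * (K * norm A)) ^ k)"
      by (simp add: field_simps)
  qed
qed

lemma mat_exp_scaleR: "mat_exp (s *\<^sub>R A) = (\<Sum>k. (s ^ k / fact k) *\<^sub>R mat_pow A k)"
  unfolding mat_exp_def mat_pow_def[symmetric] mat_pow_scaleR by simp

lemma bounded_linear_matrix_nth: "bounded_linear (\<lambda>M :: real^'m^'n. M $ i $ j)"
  by (intro bounded_linear_compose[OF bounded_linear_vec_nth bounded_linear_vec_nth])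

lemma summable_mat_pow_nth: "summable (\<lambda>k. mat_pow A k $ i $ j / fact k * s ^ k)"
  using bounded_linear.summable[OF bounded_linear_matrix_nth[of i j] summable_mat_pow[of s A]]
  by (simp add: mult_ac)

text \<open>Entrywise the exponential is a scalar power series in \<open>s\<close>, the form needed
  for termwise differentiation and for computing the last row.\<close>

lemma mat_exp_nth: "mat_exp (s *\<^sub>R A) $ i $ j = (\<Sum>k. mat_pow A k $ i $ j / fact k * s ^ k)"
  unfolding mat_exp_scaleR
  using bounded_linear.suminf[OF bounded_linear_matrix_nth[of i j] summable_mat_pow[of s A]]
  by (simp add: mult_ac)

lemma mat_exp_zero: "mat_exp (0 :: real^'n^'n) = mat 1"
proof -
  have "mat_exp (0 *\<^sub>R (0 :: real^'n^'n)) = (\<Sum>k. if k = 0 then mat 1 else 0)"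
    unfolding mat_exp_scaleR by (intro suminf_cong) auto
  also have "\<dots> = mat 1"
    by (subst suminf_finite[where N = "{0}"]) auto
  finally show ?thesis by simp
qed

lemma mat_exp_commute: "mat_exp (s *\<^sub>R A) ** A = A ** mat_exp (s *\<^sub>R A)"
proof -
  note bb = bounded_bilinear_matrix_matrix_mult
  have "mat_exp (s *\<^sub>R A) ** A = (\<Sum>k. ((s ^ k / fact k) *\<^sub>R mat_pow A k) ** A)"
    unfolding mat_exp_scaleR
    by (intro bounded_linear.suminf[OF bounded_bilinear.bounded_linear_left[OF bb] summable_mat_pow])
  also have "\<dots> = (\<Sum>k. A ** ((s ^ k / fact k) *\<^sub>R mat_pow A k))"
    by (simp add: bounded_bilinear.scaleR_left[OF bb] bounded_bilinear.scaleR_right[OF bb]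
        mat_pow_commute)
  also have "\<dots> = A ** mat_exp (s *\<^sub>R A)"
    unfolding mat_exp_scaleR
    by (intro bounded_linear.suminf[OF bounded_bilinear.bounded_linear_right[OF bb]
          summable_mat_pow, symmetric])
  finally show ?thesis .
qed

lemma has_vector_derivative_componentwise_matrix:
  fixes E :: "real \<Rightarrow> real^'m^'n"
  assumes "\<And>i j. ((\<lambda>s. E s $ i $ j) has_field_derivative E' $ i $ j) (at s)"
  shows "(E has_vector_derivative E') (at s)"
  unfolding has_vector_derivative_def
proof (subst has_derivative_componentwise_within, intro ballI)
  fix b :: "real^'m^'n" assume "b \<in> Basis"
  then obtain i j where b: "b = axis i (axis j 1)"
    by (auto simp: Basis_vec_def)
  show "((\<lambda>x. E x \<bullet> b) has_derivative (\<lambda>x. x *\<^sub>R E' \<bullet> b)) (at s)"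
    using assms[of i j]
    by (simp add: b inner_axis has_field_derivative_def mult_commute_abs)
qed

lemma has_vector_derivative_mat_exp:
  "((\<lambda>s. mat_exp (s *\<^sub>R A)) has_vector_derivative (A ** mat_exp (s *\<^sub>R A))) (at s)"
proof (rule has_vector_derivative_componentwise_matrix)
  fix i j
  let ?c = "\<lambda>i k. mat_pow A k $ i $ j / fact k"
  \<comment> \<open>The factor \<open>k + 1\<close> from \<open>diffs\<close> cancels against
    \<open>fact (Suc k)\<close>, and the additional factor \<open>A\<close> of
    \<open>mat_pow A (Suc k)\<close> is expanded along row \<open>i\<close>.\<close>
  have "(\<Sum>k. diffs (?c i) k * s ^ k) = (\<Sum>k. \<Sum>l\<in>UNIV. A $ i $ l * (?c l k * s ^ k))"
    by (intro suminf_cong)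
      (simp add: diffs_def matrix_matrix_mult_def sum_distrib_right sum_distrib_left
        divide_simps mult_ac del: of_nat_Suc)
  also have "\<dots> = (\<Sum>l\<in>UNIV. \<Sum>k. A $ i $ l * (?c l k * s ^ k))"
    by (intro suminf_sum summable_mult summable_mat_pow_nth)
  also have "\<dots> = (A ** mat_exp (s *\<^sub>R A)) $ i $ j"
    unfolding suminf_mult[OF summable_mat_pow_nth] by (simp add: matrix_matrix_mult_def mat_exp_nth)
  finally have "(\<Sum>k. diffs (?c i) k * s ^ k) = (A ** mat_exp (s *\<^sub>R A)) $ i $ j" .
  then show "((\<lambda>s. mat_exp (s *\<^sub>R A) $ i $ j) has_field_derivative
      (A ** mat_exp (s *\<^sub>R A)) $ i $ j) (at s)"
    using termdiffs_strong_converges_everywhere[of "?c i" s] summable_mat_pow_nth[of A i j]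
    unfolding mat_exp_nth by simp
qed

text \<open>For fixed \<open>t\<close> the product of the exponentials of \<open>- s\<close> and
  \<open>s + t\<close> has derivative zero in \<open>s\<close>, so it keeps its value at
  \<open>s = 0\<close>. The case \<open>t = 0\<close> gives inverses, and multiplying by the inverse
  gives the addition law.\<close>

lemma mat_exp_add: "mat_exp ((s + t) *\<^sub>R A) = mat_exp (s *\<^sub>R A) ** mat_exp (t *\<^sub>R A)"
proof -
  note bb = bounded_bilinear_matrix_matrix_mult
  have deriv: "((\<lambda>s. mat_exp ((- s) *\<^sub>R A) ** mat_exp ((s + t) *\<^sub>R A))
      has_vector_derivative 0) (at s within UNIV)" for s t
  proof -
    have 1: "((\<lambda>s. mat_exp ((- s) *\<^sub>R A)) has_vector_derivative - (A ** mat_exp ((- s) *\<^sub>R A))) (at s)"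
      using vector_diff_chain_at[where f = uminus and f' = "-1" and x = s,
          OF _ has_vector_derivative_mat_exp[of A "- s"]]
        has_vector_derivative_minus[OF has_vector_derivative_id]
      by (simp add: o_def)
    have "((\<lambda>s. s + t) has_vector_derivative 1) (at s)"
      using has_vector_derivative_add[OF has_vector_derivative_id has_vector_derivative_const]
      by simp
    from vector_diff_chain_at[OF this has_vector_derivative_mat_exp[of A "s + t"]]
    have 2: "((\<lambda>s. mat_exp ((s + t) *\<^sub>R A)) has_vector_derivative (A ** mat_exp ((s + t) *\<^sub>R A))) (at s)"
      by (simp add: o_def)
    let ?X = "mat_exp ((- s) *\<^sub>R A)" and ?Y = "mat_exp ((s + t) *\<^sub>R A)"
    have "?X ** (A ** ?Y) + - (A ** ?X) ** ?Y = 0"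
      by (simp only: bounded_bilinear.minus_left[OF bb] matrix_mul_assoc mat_exp_commute right_minus)
    with bounded_bilinear.has_vector_derivative[OF bb 1 2] show ?thesis
      by (simp only:)
  qed
  have inv: "mat_exp ((- s) *\<^sub>R A) ** mat_exp ((s + t) *\<^sub>R A) = mat_exp (t *\<^sub>R A)" for s t
  proof -
    obtain M where M: "\<And>s. s \<in> UNIV \<Longrightarrow> mat_exp ((- s) *\<^sub>R A) ** mat_exp ((s + t) *\<^sub>R A) = M"
      by (rule has_vector_derivative_zero_constant[OF convex_UNIV deriv[of t]]) auto
    have "mat_exp (t *\<^sub>R A) = M"
      using M[of 0] by (simp add: mat_exp_zero)
    with M[of s] show ?thesis by simp
  qed
  have "mat_exp (s *\<^sub>R A) ** mat_exp (- s *\<^sub>R A) = mat 1"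
    using inv[of "- s" 0] inv[of "-s" s]
    by (simp add: mat_exp_zero)
  then have "mat_exp ((s + t) *\<^sub>R A)
      = mat_exp (s *\<^sub>R A) ** (mat_exp (- s *\<^sub>R A) ** mat_exp ((s + t) *\<^sub>R A))"
    by (simp add: matrix_mul_assoc)
  then show ?thesis by (simp only: inv)
qed

lemma continuous_on_mat_exp: "continuous_on S (\<lambda>s. mat_exp (s *\<^sub>R A))"
  by (intro continuous_at_imp_continuous_on ballI
      has_vector_derivative_continuous[OF has_vector_derivative_mat_exp])

section \<open>Real powers of a matrix\<close>

lemma mat_powr_mult:
  "0 < x \<Longrightarrow> 0 < y \<Longrightarrow> mat_powr (x * y) B = mat_powr x B ** mat_powr y B"
  by (simp add: mat_powr_def ln_mult mat_exp_add)

lemma mat_powr_one: "mat_powr 1 B = mat 1"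
  by (simp add: mat_powr_def mat_exp_zero)

lemma continuous_on_mat_powr: "S \<subseteq> {0<..} \<Longrightarrow> continuous_on S (\<lambda>x. mat_powr x B)"
  unfolding mat_powr_def
  by (rule continuous_on_compose2[OF continuous_on_mat_exp[of UNIV] continuous_on_ln])
    (auto intro: continuous_intros)

text \<open>Triangularity leaves only the diagonal entry in the last row of every power of
  \<open>B\<close>. This decouples the last component of a rate vector from the others and makes it
  a scalar rate.\<close>

lemma mat_powr_last_row:
  fixes B :: "real^('n::{finite,linorder})^('n::{finite,linorder})"
  assumes B: "\<And>i j. j < i \<Longrightarrow> B $ i $ j = 0" and x: "0 < x"
  shows "(mat_powr x B *v v) $ last_ix = x powr (B $ last_ix $ last_ix) * v $ last_ix"
proof -
  let ?n = "last_ix :: 'n"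
  have less: "j < ?n" if "j \<noteq> ?n" for j
    using that Max_ge[of "UNIV :: 'n set" j] by (simp add: last_ix_def order.strict_iff_order)
  have pow: "mat_pow B k $ ?n $ j = (if j = ?n then (B $ ?n $ ?n) ^ k else 0)" for k j
  proof (induction k)
    case (Suc k)
    have "mat_pow B (Suc k) $ ?n $ j = (\<Sum>l\<in>UNIV. B $ ?n $ l * mat_pow B k $ l $ j)"
      by (simp add: matrix_matrix_mult_def)
    also have "\<dots> = (\<Sum>l\<in>UNIV. if l = ?n then B $ ?n $ ?n * mat_pow B k $ ?n $ j else 0)"
    proof (intro sum.cong refl)
      fix l :: 'n
      show "B $ ?n $ l * mat_pow B k $ l $ j = (if l = ?n then B $ ?n $ ?n * mat_pow B k $ ?n $ j else 0)"
        using B[OF less, of l] by (cases "l = ?n") simp_all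
    qed
    finally show ?case by (simp add: Suc.IH)
  qed (simp add: mat_def)
  have "mat_powr x B $ ?n $ j = (if j = ?n then x powr (B $ ?n $ ?n) else 0)" for j
  proof -
    have "mat_powr x B $ ?n $ j = (\<Sum>k. if j = ?n then (B $ ?n $ ?n * ln x) ^ k / fact k else 0)"
      unfolding mat_powr_def mat_exp_nth pow by (intro suminf_cong) (simp add: power_mult_distrib)
    then show ?thesis
      using x by (simp add: powr_def exp_def scaleR_conv_of_real divide_inverse mult_ac)
  qed
  then have "(mat_powr x B *v v) $ ?n = (\<Sum>j\<in>UNIV. (if j = ?n then x powr (B $ ?n $ ?n) else 0) * v $ j)"
    by (simp add: matrix_vector_mult_def)
  also have "\<dots> = (\<Sum>j\<in>UNIV. if j = ?n then x powr (B $ ?n $ ?n) * v $ ?n else 0)"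
    by (intro sum.cong) auto
  finally show ?thesis by simp
qed

section \<open>Uniform convergence\<close>

text \<open>Dominated convergence for the indicators of the exceptional sets, with the indicator of
  the bounded interval as majorant: pointwise convergence becomes convergence in measure.\<close>

lemma tendsto_measure_exceeding_zero:
  fixes f :: "nat \<Rightarrow> real \<Rightarrow> real"
  assumes meas: "\<And>k. f k \<in> borel_measurable (lebesgue_on {a..b})"
    and conv: "\<And>x. x \<in> {a..b} \<Longrightarrow> (\<lambda>k. f k x) \<longlonglongrightarrow> 0" and "0 < \<delta>"
  shows "{x \<in> {a..b}. \<delta> \<le> \<bar>f k x\<bar>} \<in> lmeasurable"
    and "(\<lambda>k. measure lebesgue {x \<in> {a..b}. \<delta> \<le> \<bar>f k x\<bar>}) \<longlonglongrightarrow> 0"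
proof -
  let ?N = "\<lambda>k. {x \<in> {a..b}. \<delta> \<le> \<bar>f k x\<bar>}"
  have sets: "?N k \<in> sets lebesgue" for k
  proof -
    have "{x \<in> space (lebesgue_on {a..b}). \<delta> \<le> \<bar>f k x\<bar>} \<in> sets (lebesgue_on {a..b})"
      by (intro borel_measurable_le borel_measurable_const borel_measurable_abs meas)
    then show ?thesis
      by (subst (asm) sets_restrict_space_iff) (auto simp: Int_def)
  qed
  show lm: "?N k \<in> lmeasurable" for k
    by (rule fmeasurableI2[OF lmeasurable_interval(1)[of a b] _ sets]) auto
  have "(\<lambda>k. integral\<^sup>L lebesgue (indicator (?N k))) \<longlonglongrightarrow> integral\<^sup>L lebesgue (\<lambda>_ :: real. 0 :: real)"
  proof (rule integral_dominated_convergence[where w = "indicator {a..b}"])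
    show "integrable lebesgue (indicator {a..b} :: real \<Rightarrow> real)"
      by (cases "a \<le> b") (simp_all add: integrable_indicator_iff)
    show "AE x in lebesgue. (\<lambda>k. indicator (?N k) x :: real) \<longlonglongrightarrow> 0"
    proof (rule AE_I2, cases)
      fix x assume x: "x \<in> {a..b}"
      have "\<forall>\<^sub>F k in sequentially. \<bar>f k x\<bar> < \<delta>"
        using tendstoD[OF conv[OF x] \<open>0 < \<delta>\<close>] by simp
      then have "\<forall>\<^sub>F k in sequentially. indicator (?N k) x = (0::real)"
        by eventually_elim auto
      then show "(\<lambda>k. indicator (?N k) x :: real) \<longlonglongrightarrow> 0"
        by (rule tendsto_eventually)
    qed auto
    show "AE x in lebesgue. norm (indicator (?N k) x :: real) \<le> indicator {a..b} x" for k
      by (auto simp: indicator_def)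
  qed (use sets in auto)
  then show "(\<lambda>k. measure lebesgue (?N k)) \<longlonglongrightarrow> 0"
    by simp
qed

text \<open>If uniformity fails at points \<open>X k\<close> and times \<open>T k\<close>, then for
  each \<open>y\<close> in \<open>{1..2}\<close> one of the two terms on the right of
  \<open>ineq\<close> stays away from zero. Each alternative confines \<open>y\<close> to a set
  whose measure tends to zero, yet together these sets would cover an interval of length one. Asking
  for an inequality with a constant, rather than an exact cocycle identity, admits norms of vectors
  as well.\<close>

lemma uniform_convergence_of_cocycle:
  fixes d :: "real \<Rightarrow> real \<Rightarrow> real"
  assumes pq: "0 < p" "p \<le> q"
    and conv: "\<And>x. 0 < x \<Longrightarrow> (d x \<longlongrightarrow> 0) at_top"
    and meas: "\<And>r. 0 < r \<Longrightarrow> \<forall>\<^sub>F t in at_top. (\<lambda>x. d x t) \<in> borel_measurable (lebesgue_on {r..})"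
    and ineq: "\<forall>\<^sub>F t in at_top. \<forall>x\<in>{p..q}. \<forall>y\<in>{1..2}.
        \<bar>d x t\<bar> \<le> C * (\<bar>d (x * y) t\<bar> + \<bar>d y (x * t)\<bar>)"
    and "0 < e"
  shows "\<forall>\<^sub>F t in at_top. \<forall>x\<in>{p..q}. \<bar>d x t\<bar> < e"
proof (rule ccontr)
  assume "\<not> ?thesis"
  then have freq: "\<exists>\<^sub>F t in at_top. \<exists>x\<in>{p..q}. e \<le> \<bar>d x t\<bar>"
    by (simp add: not_eventually not_less)
  \<comment> \<open>Measurability in \<open>x\<close> is needed both on \<open>{p..2*q}\<close> and
    on \<open>{1..2}\<close>; \<open>r\<close> lies below both intervals.\<close>
  define r where "r = min 1 p"
  have r: "0 < r" "r \<le> 1" "r \<le> p" using pq by (auto simp: r_def)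
  obtain t1 where t1: "\<And>t. t1 \<le> t \<Longrightarrow> (\<lambda>x. d x t) \<in> borel_measurable (lebesgue_on {r..})"
    using meas[OF r(1)] by (auto simp: eventually_at_top_linorder)
  \<comment> \<open>The condition \<open>t1 / p \<le> t\<close> puts the later starting points
    \<open>X k * T k\<close> beyond \<open>t1\<close> as well, so that \<open>d\<close> is
    measurable from there.\<close>
  have "\<forall>k. \<exists>t. real k \<le> t \<and> t1 \<le> t \<and> t1 / p \<le> t \<and> (\<forall>x\<in>{p..q}. \<forall>y\<in>{1..2}.
      \<bar>d x t\<bar> \<le> C * (\<bar>d (x * y) t\<bar> + \<bar>d y (x * t)\<bar>)) \<and> (\<exists>x\<in>{p..q}. e \<le> \<bar>d x t\<bar>)"
    (is "\<forall>k. \<exists>t. ?P k t")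
  proof
    fix k :: nat
    have "\<forall>\<^sub>F t in at_top. real k \<le> t \<and> t1 \<le> t \<and> t1 / p \<le> t \<and> (\<forall>x\<in>{p..q}. \<forall>y\<in>{1..2}.
      \<bar>d x t\<bar> \<le> C * (\<bar>d (x * y) t\<bar> + \<bar>d y (x * t)\<bar>))"
      by (intro eventually_conj ineq eventually_ge_at_top)
    from frequently_ex[OF frequently_eventually_conj[OF freq this]] show "\<exists>t. ?P k t"
      by (simp only: conj_assoc)
  qed
  from choice[OF this] obtain T where P: "\<forall>k. ?P k (T k)" ..
  have T: "real k \<le> T k" "t1 \<le> T k" "t1 / p \<le> T k" for k
    using P[rule_format, of k] by simp_all
  have ineq': "\<bar>d x (T k)\<bar> \<le> C * (\<bar>d (x * y) (T k)\<bar> + \<bar>d y (x * T k)\<bar>)"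
    if "x \<in> {p..q}" "y \<in> {1..2}" for k x y
    using P[rule_format, of k] that by blast
  have "\<forall>k. \<exists>x. x \<in> {p..q} \<and> e \<le> \<bar>d x (T k)\<bar>"
    using P by blast
  from choice[OF this] obtain X where X: "\<And>k. p \<le> X k" "\<And>k. X k \<le> q"
    and large: "\<And>k. e \<le> \<bar>d (X k) (T k)\<bar>"
    by auto
  have XT: "p * T k \<le> X k * T k" for k
    by (rule mult_right_mono[OF X(1) order_trans[OF of_nat_0_le_iff T(1)]])
  \<comment> \<open>Passing to \<open>K\<close> makes the constant positive. The choice of
    \<open>\<delta>\<close> gives \<open>K * (\<delta> + \<delta>) = e\<close>, so two terms below
    \<open>\<delta>\<close> would contradict the lower bound \<open>e\<close> at
    \<open>X k\<close>.\<close>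
  define K where "K = max C 1"
  define \<delta> where "\<delta> = e / (2 * K)"
  have K: "C \<le> K" "0 < K" and \<delta>: "0 < \<delta>" "K * (\<delta> + \<delta>) = e"
    using \<open>0 < e\<close> by (auto simp: K_def \<delta>_def field_simps)
  \<comment> \<open>The variable of \<open>N\<close> is the product \<open>X k * y\<close>, which
    ranges within \<open>{p..2*q}\<close>; that of \<open>N'\<close> is \<open>y\<close>
    itself.\<close>
  define N where "N = (\<lambda>k. {z \<in> {p..2*q}. \<delta> \<le> \<bar>d z (T k)\<bar>})"
  define N' where "N' = (\<lambda>k. {y \<in> {1..2}. \<delta> \<le> \<bar>d y (X k * T k)\<bar>})"
  have T_lim: "filterlim T at_top sequentially"
    using T(1) by (intro filterlim_at_top_mono[OF filterlim_real_sequentially]) auto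
  have "filterlim (\<lambda>k. p * T k) at_top sequentially"
    by (rule filterlim_tendsto_pos_mult_at_top[OF tendsto_const pq(1) T_lim])
  then have XT_lim: "filterlim (\<lambda>k. X k * T k) at_top sequentially"
    by (rule filterlim_at_top_mono) (use XT in auto)
  have N: "N k \<in> lmeasurable" "(\<lambda>k. measure lebesgue (N k)) \<longlonglongrightarrow> 0" for k
  proof -
    have *: "(\<lambda>x. d x (T k)) \<in> borel_measurable (lebesgue_on {p..2*q})" for k
      by (rule measurable_restrict_mono[OF t1[OF T(2)]]) (use r in auto)
    have **: "(\<lambda>k. d x (T k)) \<longlonglongrightarrow> 0" if "x \<in> {p..2*q}" for x
      using that pq by (intro filterlim_compose[OF conv T_lim]) auto
    show "N k \<in> lmeasurable" "(\<lambda>k. measure lebesgue (N k)) \<longlonglongrightarrow> 0"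
      unfolding N_def
      by (rule tendsto_measure_exceeding_zero[where f = "\<lambda>k x. d x (T k)", OF * ** \<delta>(1)]; assumption)+
  qed
  have N': "N' k \<in> lmeasurable" "(\<lambda>k. measure lebesgue (N' k)) \<longlonglongrightarrow> 0" for k
  proof -
    have "t1 \<le> X k * T k" for k
      using T(3)[of k] XT[of k] pq(1) by (simp add: field_simps)
    then have *: "(\<lambda>x. d x (X k * T k)) \<in> borel_measurable (lebesgue_on {1..2})" for k
      by (intro measurable_restrict_mono[OF t1]) (use r in auto)
    have **: "(\<lambda>k. d x (X k * T k)) \<longlonglongrightarrow> 0" if "x \<in> {1..2}" for x
      using that by (intro filterlim_compose[OF conv XT_lim]) auto
    show "N' k \<in> lmeasurable" "(\<lambda>k. measure lebesgue (N' k)) \<longlonglongrightarrow> 0"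
      unfolding N'_def
      by (rule tendsto_measure_exceeding_zero[where f = "\<lambda>k x. d x (X k * T k)", OF * ** \<delta>(1)]; assumption)+
  qed
  \<comment> \<open>Returning from \<open>X k * y\<close> to \<open>y\<close> multiplies the measure
    of \<open>N k\<close> by \<open>1 / X k\<close>, which is at most \<open>1 / p\<close>; the sum
    has to drop below the length of \<open>{1..2}\<close>.\<close>
  have "(\<lambda>k. 1 / p * measure lebesgue (N k) + measure lebesgue (N' k)) \<longlonglongrightarrow> 1 / p * 0 + 0"
    by (intro tendsto_intros N(2) N'(2))
  then have "\<forall>\<^sub>F k in sequentially. 1 / p * measure lebesgue (N k) + measure lebesgue (N' k) < 1"
    by (intro order_tendstoD) auto
  then obtain k where k: "1 / p * measure lebesgue (N k) + measure lebesgue (N' k) < 1"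
    using eventually_happens trivial_limit_sequentially by blast
  have Xk: "0 < X k" using X(1)[of k] pq by simp
  let ?S = "(\<lambda>z. (1 / X k) *\<^sub>R z) ` N k"
  have S: "?S \<in> lmeasurable" "measure lebesgue ?S = 1 / X k * measure lebesgue (N k)"
  proof -
    have "?S = (*\<^sub>R) (X k) -` N k \<inter> space lebesgue"
      using Xk by (force simp: image_iff field_simps)
    then have "?S \<in> sets lebesgue"
      using measurable_sets[OF lebesgue_measurable_scaling[of "X k"], of "N k"] N(1) by auto
    moreover have "emeasure lebesgue ?S = ennreal (1 / X k) * emeasure lebesgue (N k)"
      using emeasure_lebesgue_affine[of "1 / X k" 0 "N k"] Xk by simp
    ultimately show "?S \<in> lmeasurable"
      using fmeasurableD2[OF N(1)] by (intro fmeasurableI) (auto simp: ennreal_mult_less_top less_top)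
    show "measure lebesgue ?S = 1 / X k * measure lebesgue (N k)"
      using measure_lebesgue_affine[of "1 / X k" 0 "N k"] Xk by simp
  qed
  \<comment> \<open>For large \<open>k\<close> the two exceptional sets are too small to cover \<open>{1..2}\<close>.\<close>
  have "{1..2} \<subseteq> ?S \<union> N' k"
  proof
    fix y :: real assume y: "y \<in> {1..2}"
    have "X k * y \<in> {p..2*q}"
      using X[of k] y pq mult_mono[of p "X k" 1 y] mult_mono[of "X k" q y 2] by auto
    moreover have "\<delta> \<le> \<bar>d (X k * y) (T k)\<bar> \<or> \<delta> \<le> \<bar>d y (X k * T k)\<bar>"
    proof (rule ccontr)
      assume "\<not> ?thesis"
      then have "K * (\<bar>d (X k * y) (T k)\<bar> + \<bar>d y (X k * T k)\<bar>) < K * (\<delta> + \<delta>)"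
        using K by (intro mult_strict_left_mono) auto
      moreover have "\<bar>d (X k) (T k)\<bar> \<le> K * (\<bar>d (X k * y) (T k)\<bar> + \<bar>d y (X k * T k)\<bar>)"
      proof -
        have "\<bar>d (X k) (T k)\<bar> \<le> C * (\<bar>d (X k * y) (T k)\<bar> + \<bar>d y (X k * T k)\<bar>)"
          using X y by (intro ineq') auto
        also have "\<dots> \<le> K * (\<bar>d (X k * y) (T k)\<bar> + \<bar>d y (X k * T k)\<bar>)"
          using K by (intro mult_right_mono) auto
        finally show ?thesis .
      qed
      ultimately show False using large[of k] \<delta> by simp
    qed
    moreover have "y = (1 / X k) *\<^sub>R (X k * y)" using Xk by simp
    ultimately show "y \<in> ?S \<union> N' k"
      using y unfolding N_def N'_def by blast
  qed
  then have "measure lebesgue {1..2::real} \<le> measure lebesgue (?S \<union> N' k)"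
    using S N' by (intro measure_mono_fmeasurable) auto
  also have "\<dots> \<le> 1 / X k * measure lebesgue (N k) + measure lebesgue (N' k)"
    using measure_Un_le[of ?S lebesgue "N' k"] S N' by auto
  also have "\<dots> \<le> 1 / p * measure lebesgue (N k) + measure lebesgue (N' k)"
    using X(1)[of k] pq by (intro add_right_mono mult_right_mono divide_left_mono) auto
  finally show False using k by simp
qed

section \<open>Increments of order \<open>o(\<gamma>)\<close>\<close>

lemma measurable_scaling_Ici:
  fixes F :: "real \<Rightarrow> 'a::topological_space"
  assumes F: "F \<in> borel_measurable (lebesgue_on {a..})" and "0 \<le> t" "a \<le> r * t"
  shows "(\<lambda>x. F (x * t)) \<in> borel_measurable (lebesgue_on {r..})"
proof -
  have "(*\<^sub>R) t \<in> {r..} \<rightarrow> {a..}"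
  proof
    fix x assume "x \<in> {r..}"
    then have "r * t \<le> t *\<^sub>R x"
      using mult_left_mono[OF _ assms(2), of r x] by (simp add: mult.commute)
    with assms(3) show "t *\<^sub>R x \<in> {a..}" by simp
  qed
  from measurable_compose[OF measurable_restrict_space3[OF lebesgue_measurable_scaling this] F]
  show ?thesis by (simp add: mult.commute)
qed

lemma eventually_measurable_scaled:
  fixes F :: "real \<Rightarrow> 'a::topological_space"
  assumes "measurable_near_infinity F" "0 < r"
  shows "\<forall>\<^sub>F t in at_top. (\<lambda>x. F (x * t)) \<in> borel_measurable (lebesgue_on {r..})"
proof -
  obtain t0 where t0: "F \<in> borel_measurable (lebesgue_on {t0..})"
    using assms(1) by (auto simp: measurable_near_infinity_def)
  show ?thesis
    using eventually_ge_at_top[of 0] eventually_ge_at_top[of "t0 / r"]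
  proof eventually_elim
    case (elim t)
    then show ?case
      using assms(2) by (intro measurable_scaling_Ici[OF t0]) (auto simp: field_simps)
  qed
qed

text \<open>Bounds on the dyadic pieces from \<open>2^n * a\<close> to \<open>2^(n+1) * a\<close>
  are chained until they pass \<open>b\<close>. The threshold \<open>a0\<close> works for every
  later \<open>a\<close>, which allows several thresholds to be merged by a maximum.\<close>

lemma locally_bounded_near_infinity:
  fixes F :: "real \<Rightarrow> 'a::real_normed_vector"
  assumes meas: "measurable_near_infinity F"
    and bdd: "\<forall>\<^sub>F t in at_top. \<exists>M. \<forall>x\<in>{1..2}. norm (F (x * t)) \<le> M"
  shows "\<exists>a0>0. \<forall>a\<ge>a0. F \<in> borel_measurable (lebesgue_on {a..}) \<and>
    (\<forall>b. \<exists>M. \<forall>u\<in>{a..b}. norm (F u) \<le> M)"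
proof -
  obtain t0 where t0: "F \<in> borel_measurable (lebesgue_on {t0..})"
    using meas by (auto simp: measurable_near_infinity_def)
  obtain t1 where t1: "\<And>t. t1 \<le> t \<Longrightarrow> \<exists>M. \<forall>x\<in>{1..2}. norm (F (x * t)) \<le> M"
    using bdd by (auto simp: eventually_at_top_linorder)
  define a0 where "a0 = max 1 (max t0 t1)"
  have "\<exists>M. \<forall>u\<in>{a..b}. norm (F u) \<le> M" if a: "a0 \<le> a" for a b
  proof -
    have a': "0 < a" "t1 \<le> a" using a by (auto simp: a0_def)
    have pow: "\<exists>M. \<forall>u\<in>{a..2^n * a}. norm (F u) \<le> M" for n
    proof (induction n)
      case 0
      show ?case by (intro exI[of _ "norm (F a)"]) auto
    next
      case (Suc n)
      then obtain M where M: "\<forall>u\<in>{a..2^n * a}. norm (F u) \<le> M" by blast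
      have na: "a \<le> 2 ^ n * a" using a' by simp
      then obtain M' where M': "\<forall>x\<in>{1..2}. norm (F (x * (2^n * a))) \<le> M'"
        using t1[OF order_trans[OF a'(2) na]] by blast
      have "norm (F u) \<le> max M M'" if u: "u \<in> {a..2^Suc n * a}" for u
      proof (cases "u \<le> 2^n * a")
        case True
        then show ?thesis using M u by (simp add: le_max_iff_disj)
      next
        case False
        then have "u / (2^n * a) \<in> {1..2}"
          using u a' by (auto simp: field_simps)
        with M' have "norm (F (u / (2^n * a) * (2^n * a))) \<le> M'" by blast
        then show ?thesis using a' by (simp add: le_max_iff_disj)
      qed
      then show ?case by blast
    qed
    obtain n where "b / a < 2 ^ n"
      using real_arch_pow[of 2 "b / a"] by auto
    then have "b \<le> 2 ^ n * a" using a' by (simp add: field_simps)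
    with pow[of n] show ?thesis by (meson atLeastAtMost_iff order_trans)
  qed
  moreover have "F \<in> borel_measurable (lebesgue_on {a..})" if "a0 \<le> a" for a
    by (rule measurable_restrict_mono[OF t0]) (use that in \<open>auto simp: a0_def\<close>)
  ultimately show ?thesis
    by (intro exI[of _ a0]) (auto simp: a0_def)
qed

lemma absolutely_integrable_over_id:
  fixes F :: "real \<Rightarrow> real"
  assumes F: "F \<in> borel_measurable (lebesgue_on {a..})" and "0 < a"
    and M: "\<And>u. u \<in> {a..b} \<Longrightarrow> \<bar>F u\<bar> \<le> M"
  shows "(\<lambda>u. F u / u) absolutely_integrable_on {a..b}"
proof (rule measurable_bounded_by_integrable_imp_absolutely_integrable)
  have "F \<in> borel_measurable (lebesgue_on {a..b})"
    by (rule measurable_restrict_mono[OF F]) auto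
  then show "(\<lambda>u. F u / u) \<in> borel_measurable (lebesgue_on {a..b})"
    by (intro borel_measurable_divide) (auto simp: id_def[symmetric])
  show "norm (F u / u) \<le> M / a" if "u \<in> {a..b}" for u
    using M[OF that] that \<open>0 < a\<close> by (auto simp: abs_divide intro!: frac_le order_trans[OF abs_ge_zero M])
qed auto

lemma continuous_on_integral_Ici:
  fixes F :: "real \<Rightarrow> 'a::banach"
  assumes "\<And>b. F integrable_on {a..b}"
  shows "continuous_on {a..} (\<lambda>t. integral {a..t} F)"
  unfolding continuous_on_eq_continuous_within
proof
  fix t assume t: "t \<in> {a..}"
  have "at t within {a..} = at t within {a..t + 1}"
    by (rule at_within_nhd[of _ "{..<t + 1}"]) auto
  moreover have "continuous (at t within {a..t + 1}) (\<lambda>t. integral {a..t} F)"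
    using indefinite_integral_continuous_1[OF assms, of "t + 1"] t
    by (auto simp: continuous_on_eq_continuous_within)
  ultimately show "continuous (at t within {a..}) (\<lambda>t. integral {a..t} F)" by simp
qed

text \<open>Abstracts the last component of the rate vector, with \<open>\<rho>\<close> the last
  diagonal element of \<open>B\<close>. All error terms are measured against it, so the case
  \<open>c = 0\<close> can be settled in this scalar setting.\<close>

locale rate_function =
  fixes \<gamma> :: "real \<Rightarrow> real" and \<rho> :: real
  assumes nonzero: "\<forall>\<^sub>F t in at_top. \<gamma> t \<noteq> 0"
    and meas: "measurable_near_infinity \<gamma>"
    and ratio: "\<And>x. 0 < x \<Longrightarrow> ((\<lambda>t. \<gamma> (x * t) / \<gamma> t) \<longlongrightarrow> x powr \<rho>) at_top"
begin

section \<open>Uniform bounds relative to a scalar rate\<close>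

lemma eventually_nonzero_from:
  assumes "0 < p"
  shows "\<forall>\<^sub>F t in at_top. \<forall>x\<ge>p. \<gamma> (x * t) \<noteq> 0"
proof -
  obtain t0 where t0: "\<And>t. t0 \<le> t \<Longrightarrow> \<gamma> t \<noteq> 0"
    using nonzero by (auto simp: eventually_at_top_linorder)
  show ?thesis
    using eventually_ge_at_top[of 0] eventually_ge_at_top[of "t0 / p"]
  proof eventually_elim
    case (elim t)
    show ?case
    proof (intro allI impI t0)
      fix x assume "p \<le> x"
      then show "t0 \<le> x * t"
        using elim assms mult_right_mono[of p x t] by (simp add: field_simps)
    qed
  qed
qed

text \<open>The logarithm of the ratio, less its limit \<open>\<rho> * ln x\<close>, is an exact
  cocycle: \<open>d x t = d (x * y) t - d y (x * t)\<close>. Uniform closeness within 1 suffices,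
  and the exponent in the final constant adds to this 1 a bound for \<open>\<rho> * ln x\<close> on
  \<open>{p..q}\<close>.\<close>

lemma ratio_bounded:
  assumes pq: "0 < p" "p \<le> q"
  shows "\<exists>C>0. \<forall>\<^sub>F t in at_top. \<forall>x\<in>{p..q}. \<bar>\<gamma> (x * t)\<bar> \<le> C * \<bar>\<gamma> t\<bar>"
proof -
  define d where "d = (\<lambda>x t. ln \<bar>\<gamma> (x * t) / \<gamma> t\<bar> - \<rho> * ln x)"
  have "\<forall>\<^sub>F t in at_top. \<forall>x\<in>{p..q}. \<bar>d x t\<bar> < 1"
  proof (rule uniform_convergence_of_cocycle[OF pq, where C = 1])
    show "(d x \<longlongrightarrow> 0) at_top" if x: "0 < x" for x
    proof -
      have "((\<lambda>t. ln \<bar>\<gamma> (x * t) / \<gamma> t\<bar> - \<rho> * ln x) \<longlongrightarrow> ln \<bar>x powr \<rho>\<bar> - \<rho> * ln x) at_top"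
        using x by (intro tendsto_intros ratio) auto
      then show ?thesis using x by (simp add: d_def ln_powr)
    qed
    show "\<forall>\<^sub>F t in at_top. (\<lambda>x. d x t) \<in> borel_measurable (lebesgue_on {r..})" if "0 < r" for r
      using eventually_measurable_scaled[OF meas that]
    proof eventually_elim
      case (elim t)
      have id: "(\<lambda>x. x) \<in> borel_measurable (lebesgue_on {r..})"
        using id_borel_measurable_lebesgue_on by (simp add: id_def)
      show ?case unfolding d_def
        by (intro borel_measurable_diff borel_measurable_times borel_measurable_const
            borel_measurable_ln borel_measurable_abs borel_measurable_divide elim id)
    qed
    show "\<forall>\<^sub>F t in at_top. \<forall>x\<in>{p..q}. \<forall>y\<in>{1..2}.
        \<bar>d x t\<bar> \<le> 1 * (\<bar>d (x * y) t\<bar> + \<bar>d y (x * t)\<bar>)"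
      using eventually_nonzero_from[OF pq(1)] nonzero
    proof eventually_elim
      case (elim t)
      show ?case
      proof (intro ballI)
        fix x y assume xy: "x \<in> {p..q}" "y \<in> {1..2::real}"
        have "p * 1 \<le> x * y" using xy pq by (intro mult_mono) auto
        then have nz: "\<gamma> t \<noteq> 0" "\<gamma> (x * t) \<noteq> 0" "\<gamma> (x * y * t) \<noteq> 0"
          using elim xy by auto
        have "d x t = d (x * y) t - d y (x * t)"
          using nz xy pq by (simp add: d_def abs_divide ln_div ln_mult algebra_simps)
        then show "\<bar>d x t\<bar> \<le> 1 * (\<bar>d (x * y) t\<bar> + \<bar>d y (x * t)\<bar>)" by simp
      qed
    qed
  qed auto
  then have "\<forall>\<^sub>F t in at_top. \<forall>x\<in>{p..q}. \<bar>\<gamma> (x * t)\<bar>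
      \<le> exp (1 + \<bar>\<rho>\<bar> * (\<bar>ln p\<bar> + \<bar>ln q\<bar>)) * \<bar>\<gamma> t\<bar>"
    using eventually_nonzero_from[OF pq(1)] nonzero
  proof eventually_elim
    case (elim t)
    show ?case
    proof
      fix x assume x: "x \<in> {p..q}"
      have "\<bar>ln x\<bar> \<le> \<bar>ln p\<bar> + \<bar>ln q\<bar>"
      proof -
        have "ln p \<le> ln x" "ln x \<le> ln q" using x pq by auto
        then show ?thesis by linarith
      qed
      then have "\<bar>\<rho> * ln x\<bar> \<le> \<bar>\<rho>\<bar> * (\<bar>ln p\<bar> + \<bar>ln q\<bar>)"
        unfolding abs_mult by (rule mult_left_mono) simp
      then have "ln \<bar>\<gamma> (x * t) / \<gamma> t\<bar> \<le> 1 + \<bar>\<rho>\<bar> * (\<bar>ln p\<bar> + \<bar>ln q\<bar>)"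
        using bspec[OF elim(1) x] unfolding d_def by linarith
      moreover have "0 < \<bar>\<gamma> (x * t) / \<gamma> t\<bar>" using elim(2,3) x by auto
      ultimately have "\<bar>\<gamma> (x * t) / \<gamma> t\<bar> \<le> exp (1 + \<bar>\<rho>\<bar> * (\<bar>ln p\<bar> + \<bar>ln q\<bar>))"
        by (metis exp_le_cancel_iff exp_ln)
      then show "\<bar>\<gamma> (x * t)\<bar> \<le> exp (1 + \<bar>\<rho>\<bar> * (\<bar>ln p\<bar> + \<bar>ln q\<bar>)) * \<bar>\<gamma> t\<bar>"
        using elim(3) by (simp add: abs_divide divide_le_eq)
    qed
  qed
  then show ?thesis
    by (intro exI[of _ "exp (1 + \<bar>\<rho>\<bar> * (\<bar>ln p\<bar> + \<bar>ln q\<bar>))"]) auto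
qed

text \<open>Dividing by \<open>\<gamma>\<close> gives functions tending to zero, but
  \<open>D y (x * t)\<close> is then normalised by \<open>\<gamma> (x * t)\<close> instead of
  \<open>\<gamma> t\<close>. Changing the normalisation costs the factor from
  \<open>ratio_bounded\<close>, whence the constant \<open>\<bar>C\<bar> * max 1 K\<close>.\<close>

lemma uniform_smallo_of_cocycle:
  fixes D :: "real \<Rightarrow> real \<Rightarrow> real"
  assumes pq: "0 < p" "p \<le> q" and "0 < e"
    and conv: "\<And>x. 0 < x \<Longrightarrow> D x \<in> o[at_top](\<gamma>)"
    and meas: "\<And>r. 0 < r \<Longrightarrow> \<forall>\<^sub>F t in at_top. (\<lambda>x. D x t) \<in> borel_measurable (lebesgue_on {r..})"
    and ineq: "\<forall>\<^sub>F t in at_top. \<forall>x\<in>{p..q}. \<forall>y\<in>{1..2}.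
        \<bar>D x t\<bar> \<le> C * (\<bar>D (x * y) t\<bar> + \<bar>D y (x * t)\<bar>)"
  shows "\<forall>\<^sub>F t in at_top. \<forall>x\<in>{p..q}. \<bar>D x t\<bar> \<le> e * \<bar>\<gamma> t\<bar>"
proof -
  obtain K where K: "\<forall>\<^sub>F t in at_top. \<forall>x\<in>{p..q}. \<bar>\<gamma> (x * t)\<bar> \<le> K * \<bar>\<gamma> t\<bar>"
    using ratio_bounded[OF pq] by blast
  define d where "d = (\<lambda>x t. D x t / \<gamma> t)"
  have "\<forall>\<^sub>F t in at_top. \<forall>x\<in>{p..q}. \<bar>d x t\<bar> < e"
  proof (rule uniform_convergence_of_cocycle[OF pq, where C = "\<bar>C\<bar> * max 1 K"])
    show "(d x \<longlongrightarrow> 0) at_top" if "0 < x" for x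
      unfolding d_def by (rule smalloD_tendsto[OF conv[OF that]])
    show "\<forall>\<^sub>F t in at_top. (\<lambda>x. d x t) \<in> borel_measurable (lebesgue_on {r..})" if "0 < r" for r
      using meas[OF that] unfolding d_def
      by eventually_elim (intro borel_measurable_divide borel_measurable_const)
    show "\<forall>\<^sub>F t in at_top. \<forall>x\<in>{p..q}. \<forall>y\<in>{1..2}.
        \<bar>d x t\<bar> \<le> \<bar>C\<bar> * max 1 K * (\<bar>d (x * y) t\<bar> + \<bar>d y (x * t)\<bar>)"
      using ineq K eventually_nonzero_from[OF pq(1)] nonzero
    proof eventually_elim
      case (elim t)
      show ?case
      proof (intro ballI)
        fix x y assume xy: "x \<in> {p..q}" "y \<in> {1..2::real}"
        have nz: "0 < \<bar>\<gamma> t\<bar>" "\<gamma> (x * t) \<noteq> 0" using elim(3,4) xy by auto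
        have "\<bar>D y (x * t)\<bar> = \<bar>d y (x * t)\<bar> * \<bar>\<gamma> (x * t)\<bar>"
          using nz by (simp add: d_def abs_divide)
        also have "\<dots> \<le> \<bar>d y (x * t)\<bar> * (max 1 K * \<bar>\<gamma> t\<bar>)"
          using elim(2) xy by (intro mult_left_mono order_trans[OF bspec[OF elim(2) xy(1)]] mult_right_mono) auto
        finally have 1: "\<bar>D y (x * t)\<bar> \<le> \<bar>d y (x * t)\<bar> * (max 1 K * \<bar>\<gamma> t\<bar>)" .
        have "\<bar>D (x * y) t\<bar> = \<bar>d (x * y) t\<bar> * (1 * \<bar>\<gamma> t\<bar>)"
          using nz by (simp add: d_def abs_divide)
        also have "\<dots> \<le> \<bar>d (x * y) t\<bar> * (max 1 K * \<bar>\<gamma> t\<bar>)"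
          by (intro mult_left_mono mult_right_mono) auto
        finally have 2: "\<bar>D (x * y) t\<bar> \<le> \<bar>d (x * y) t\<bar> * (max 1 K * \<bar>\<gamma> t\<bar>)" .
        have "\<bar>D x t\<bar> \<le> \<bar>C\<bar> * (\<bar>D (x * y) t\<bar> + \<bar>D y (x * t)\<bar>)"
          using elim(1) xy by (fastforce intro: order_trans[OF _ mult_right_mono[OF abs_ge_self]])
        also have "\<dots> \<le> \<bar>C\<bar> * (\<bar>d (x * y) t\<bar> * (max 1 K * \<bar>\<gamma> t\<bar>) + \<bar>d y (x * t)\<bar> * (max 1 K * \<bar>\<gamma> t\<bar>))"
          using 1 2 by (intro mult_left_mono add_mono) auto
        also have "\<dots> = \<bar>C\<bar> * max 1 K * (\<bar>d (x * y) t\<bar> + \<bar>d y (x * t)\<bar>) * \<bar>\<gamma> t\<bar>"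
          by (simp add: algebra_simps)
        finally show "\<bar>d x t\<bar> \<le> \<bar>C\<bar> * max 1 K * (\<bar>d (x * y) t\<bar> + \<bar>d y (x * t)\<bar>)"
          using nz by (simp add: d_def[THEN fun_cong, THEN fun_cong, of x t] abs_divide pos_divide_le_eq)
      qed
    qed
  qed fact
  with nonzero show ?thesis
  proof eventually_elim
    case (elim t)
    then show ?case by (auto simp: d_def abs_divide divide_less_eq intro!: less_imp_le)
  qed
qed

text \<open>Smallness of \<open>\<phi>\<close> at \<open>x * t\<close> is relative to
  \<open>\<gamma> (x * t)\<close>; \<open>ratio_bounded\<close> converts it to
  \<open>\<gamma> t\<close>, and \<open>e / K\<close> pays for the conversion.\<close>

lemma smallo_scaled_uniform:
  assumes pq: "0 < p" "p \<le> q" and "0 < e" and \<phi>: "\<phi> \<in> o[at_top](\<gamma>)"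
  shows "\<forall>\<^sub>F t in at_top. \<forall>x\<in>{p..q}. \<bar>\<phi> (x * t)\<bar> \<le> e * \<bar>\<gamma> t\<bar>"
proof -
  obtain K where K: "0 < K" "\<forall>\<^sub>F t in at_top. \<forall>x\<in>{p..q}. \<bar>\<gamma> (x * t)\<bar> \<le> K * \<bar>\<gamma> t\<bar>"
    using ratio_bounded[OF pq] by blast
  have "\<forall>\<^sub>F t in at_top. \<bar>\<phi> t\<bar> \<le> e / K * \<bar>\<gamma> t\<bar>"
    using landau_o.smallD[OF \<phi>, of "e / K"] \<open>0 < e\<close> K(1) by simp
  then obtain t0 where t0: "\<And>t. t0 \<le> t \<Longrightarrow> \<bar>\<phi> t\<bar> \<le> e / K * \<bar>\<gamma> t\<bar>"
    by (auto simp: eventually_at_top_linorder)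
  show ?thesis
    using K(2) eventually_ge_at_top[of "t0 / p"] eventually_ge_at_top[of 0]
  proof eventually_elim
    case (elim t)
    show ?case
    proof
      fix x assume x: "x \<in> {p..q}"
      have "t0 \<le> x * t"
        using elim(2,3) x pq mult_right_mono[of p x t] by (simp add: field_simps)
      then have "\<bar>\<phi> (x * t)\<bar> \<le> e / K * \<bar>\<gamma> (x * t)\<bar>" by (rule t0)
      also have "\<dots> \<le> e / K * (K * \<bar>\<gamma> t\<bar>)"
        using elim(1) x \<open>0 < e\<close> K(1) by (intro mult_left_mono) auto
      finally show "\<bar>\<phi> (x * t)\<bar> \<le> e * \<bar>\<gamma> t\<bar>" using K(1) by simp
    qed
  qed
qed

lemma smallo_scaled:
  assumes "0 < x" and "\<phi> \<in> o[at_top](\<gamma>)"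
  shows "(\<lambda>t. \<phi> (x * t)) \<in> o[at_top](\<gamma>)"
proof (rule landau_o.smallI)
  fix e :: real assume "0 < e"
  from smallo_scaled_uniform[OF assms(1) order_refl this assms(2)]
  show "\<forall>\<^sub>F t in at_top. norm (\<phi> (x * t)) \<le> e * norm (\<gamma> t)"
    by eventually_elim auto
qed

text \<open>The substitution \<open>u = y * t\<close> leaves du / u invariant and fixes the interval
  of integration, so a uniform approximation of \<open>F (y * t)\<close> by
  \<open>\<Phi> y t\<close> can be integrated.\<close>

lemma integral_scaled_smallo:
  assumes pq: "0 < p" "p \<le> q"
    and int: "\<And>b. (\<lambda>u. F u / u) integrable_on {a..b}"
    and cont: "\<And>t. continuous_on {p..q} (\<lambda>y. \<Phi> y t)"
    and unif: "\<And>e. 0 < e \<Longrightarrow> \<forall>\<^sub>F t in at_top. \<forall>y\<in>{p..q}. \<bar>F (y * t) - \<Phi> y t\<bar> \<le> e * \<bar>\<gamma> t\<bar>"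
  shows "(\<lambda>t. integral {p * t..q * t} (\<lambda>u. F u / u) - integral {p..q} (\<lambda>y. \<Phi> y t / y)) \<in> o[at_top](\<gamma>)"
proof (rule landau_o.smallI)
  fix e :: real assume e: "0 < e"
  \<comment> \<open>The integrand error is at most
    \<open>\<epsilon> * \<bar>\<gamma> t\<bar> / p\<close> on an interval of length
    \<open>q - p\<close>; the added 1 keeps the denominator positive when
    \<open>p = q\<close>.\<close>
  define \<epsilon> where "\<epsilon> = e * p / (q - p + 1)"
  have \<epsilon>: "0 < \<epsilon>" using e pq by (simp add: \<epsilon>_def)
  show "\<forall>\<^sub>F t in at_top. norm (integral {p * t..q * t} (\<lambda>u. F u / u) - integral {p..q} (\<lambda>y. \<Phi> y t / y))
      \<le> e * norm (\<gamma> t)"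
    using unif[OF \<epsilon>] eventually_ge_at_top[of "a / p"] eventually_gt_at_top[of 0]
  proof eventually_elim
    case (elim t)
    have "(\<lambda>u. F u / u) integrable_on {p * t..q * t}"
      using elim pq by (intro integrable_on_subinterval[OF int[of "q * t"]]) (auto simp: field_simps)
    then have I: "((\<lambda>u. F u / u) has_integral integral {p * t..q * t} (\<lambda>u. F u / u)) {p * t..q * t}"
      by (rule integrable_integral)
    have im: "(\<lambda>x. x / t) ` {p * t..q * t} = {p..q}"
      using elim pq by (simp add: image_divide_atLeastAtMost)
    have "((\<lambda>y. F (y * t) / y) has_integral integral {p * t..q * t} (\<lambda>u. F u / u)) {p..q}"
      using has_integral_mult_right[OF has_integral_stretch_real[OF I, of t], of t] elim
      unfolding im by (simp add: mult.commute)
    moreover have "(\<lambda>y. \<Phi> y t / y) integrable_on {p..q}"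
      using pq by (intro integrable_continuous_real continuous_intros cont) auto
    ultimately have "((\<lambda>y. F (y * t) / y - \<Phi> y t / y) has_integral
        integral {p * t..q * t} (\<lambda>u. F u / u) - integral {p..q} (\<lambda>y. \<Phi> y t / y)) {p..q}"
      by (intro has_integral_diff integrable_integral)
    moreover have "norm (F (y * t) / y - \<Phi> y t / y) \<le> \<epsilon> * \<bar>\<gamma> t\<bar> / p" if y: "y \<in> {p..q}" for y
    proof -
      have "norm (F (y * t) / y - \<Phi> y t / y) = \<bar>F (y * t) - \<Phi> y t\<bar> / y"
        using y pq by (simp add: abs_divide flip: diff_divide_distrib)
      also have "\<dots> \<le> \<epsilon> * \<bar>\<gamma> t\<bar> / p"
        using y pq elim(1) \<epsilon> by (intro frac_le) auto
      finally show ?thesis .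
    qed
    ultimately have "norm (integral {p * t..q * t} (\<lambda>u. F u / u) - integral {p..q} (\<lambda>y. \<Phi> y t / y))
        \<le> \<epsilon> * \<bar>\<gamma> t\<bar> / p * measure lborel {p..q}"
      using \<epsilon> pq by (intro has_integral_bound_real) auto
    also have "\<dots> = e * \<bar>\<gamma> t\<bar> * ((q - p) / (q - p + 1))"
      using pq by (simp add: \<epsilon>_def)
    also have "\<dots> \<le> e * \<bar>\<gamma> t\<bar> * 1"
      using e pq by (intro mult_left_mono) auto
    finally show ?case by simp
  qed
qed

text \<open>The approximant \<open>\<Phi>\<close> is left open because three are used:
  \<open>c \<bullet> (mat_powr y B *v g t)\<close> for the primitive of
  \<open>c \<bullet> g\<close>, the constant \<open>f t\<close> for the average, and
  \<open>0\<close> for the primitive of \<open>\<phi>\<close>. The case distinction reproduces the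
  oriented integral from 1 to \<open>x\<close>.\<close>

lemma primitive_increment:
  assumes int: "\<And>b. (\<lambda>u. F u / u) integrable_on {a..b}"
    and cont: "\<And>t. continuous_on {0<..} (\<lambda>y. \<Phi> y t)"
    and unif: "\<And>p q e. 0 < p \<Longrightarrow> p \<le> q \<Longrightarrow> 0 < e \<Longrightarrow>
      \<forall>\<^sub>F t in at_top. \<forall>y\<in>{p..q}. \<bar>F (y * t) - \<Phi> y t\<bar> \<le> e * \<bar>\<gamma> t\<bar>"
    and x: "0 < x"
  shows "(\<lambda>t. integral {a..x * t} (\<lambda>u. F u / u) - integral {a..t} (\<lambda>u. F u / u)
      - (if 1 \<le> x then integral {1..x} (\<lambda>y. \<Phi> y t / y) else - integral {x..1} (\<lambda>y. \<Phi> y t / y)))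
    \<in> o[at_top](\<gamma>)"
proof (cases "1 \<le> x")
  case True
  have "(\<lambda>t. integral {1 * t..x * t} (\<lambda>u. F u / u) - integral {1..x} (\<lambda>y. \<Phi> y t / y)) \<in> o[at_top](\<gamma>)"
    using True by (intro integral_scaled_smallo[OF _ _ int] unif continuous_on_subset[OF cont]) auto
  moreover have "\<forall>\<^sub>F t in at_top. integral {1 * t..x * t} (\<lambda>u. F u / u)
      = integral {a..x * t} (\<lambda>u. F u / u) - integral {a..t} (\<lambda>u. F u / u)"
    using eventually_ge_at_top[of a] eventually_ge_at_top[of 0]
  proof eventually_elim
    case (elim t)
    have "t \<le> x * t" using elim True mult_right_mono[of 1 x t] by simp
    with elim Henstock_Kurzweil_Integration.integral_combine[OF _ _ int, of t "x * t"]
    show ?case by simp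
  qed
  then have "\<forall>\<^sub>F t in at_top. integral {1 * t..x * t} (\<lambda>u. F u / u) - integral {1..x} (\<lambda>y. \<Phi> y t / y)
      = integral {a..x * t} (\<lambda>u. F u / u) - integral {a..t} (\<lambda>u. F u / u) - integral {1..x} (\<lambda>y. \<Phi> y t / y)"
    by eventually_elim simp
  ultimately show ?thesis
    using True by (simp only: landau_o.small.in_cong if_True)
next
  case False
  have "(\<lambda>t. - (integral {x * t..1 * t} (\<lambda>u. F u / u) - integral {x..1} (\<lambda>y. \<Phi> y t / y))) \<in> o[at_top](\<gamma>)"
    using False x unfolding landau_o.small.uminus_in_iff
    by (intro integral_scaled_smallo[OF _ _ int] unif continuous_on_subset[OF cont]) auto
  moreover have "\<forall>\<^sub>F t in at_top. - integral {x * t..1 * t} (\<lambda>u. F u / u)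
      = integral {a..x * t} (\<lambda>u. F u / u) - integral {a..t} (\<lambda>u. F u / u)"
    using eventually_ge_at_top[of "a / x"] eventually_ge_at_top[of 0]
  proof eventually_elim
    case (elim t)
    have "x * t \<le> t" using elim False mult_right_mono[of x 1 t] by simp
    moreover have "a \<le> x * t" using elim x by (simp add: field_simps)
    ultimately show ?case
      using Henstock_Kurzweil_Integration.integral_combine[OF _ _ int, of "x * t" t] by simp
  qed
  then have "\<forall>\<^sub>F t in at_top. - (integral {x * t..1 * t} (\<lambda>u. F u / u) - integral {x..1} (\<lambda>y. \<Phi> y t / y))
      = integral {a..x * t} (\<lambda>u. F u / u) - integral {a..t} (\<lambda>u. F u / u) - (- integral {x..1} (\<lambda>y. \<Phi> y t / y))"
    by eventually_elim simp
  ultimately show ?thesis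
    using False by (simp only: landau_o.small.in_cong if_False)
qed

text \<open>The growth condition of \<open>GRV\<close> for \<open>c = 0\<close>, with measurability
  kept separate.\<close>

definition slowly_increasing :: "(real \<Rightarrow> real) \<Rightarrow> bool" where
  "slowly_increasing f \<longleftrightarrow> (\<forall>x>0. (\<lambda>t. f (x * t) - f t) \<in> o[at_top](\<gamma>))"

text \<open>Increments add up exactly along \<open>t\<close>, \<open>x * t\<close>,
  \<open>x * y * t\<close>, so the triangle inequality gives the cocycle inequality with
  \<open>C = 1\<close>.\<close>

lemma slowly_increasing_uniform:
  assumes f: "measurable_near_infinity f" "slowly_increasing f"
    and pq: "0 < p" "p \<le> q" and "0 < e"
  shows "\<forall>\<^sub>F t in at_top. \<forall>x\<in>{p..q}. \<bar>f (x * t) - f t\<bar> \<le> e * \<bar>\<gamma> t\<bar>"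
proof (rule uniform_smallo_of_cocycle[where C = 1, OF pq \<open>0 < e\<close>])
  show "(\<lambda>t. f (x * t) - f t) \<in> o[at_top](\<gamma>)" if "0 < x" for x
    using f(2) that by (simp add: slowly_increasing_def)
  show "\<forall>\<^sub>F t in at_top. (\<lambda>x. f (x * t) - f t) \<in> borel_measurable (lebesgue_on {r..})" if "0 < r" for r
    using eventually_measurable_scaled[OF f(1) that]
    by eventually_elim (intro borel_measurable_diff borel_measurable_const)
  show "\<forall>\<^sub>F t in at_top. \<forall>x\<in>{p..q}. \<forall>y\<in>{1..2}.
      \<bar>f (x * t) - f t\<bar> \<le> 1 * (\<bar>f (x * y * t) - f t\<bar> + \<bar>f (y * (x * t)) - f (x * t)\<bar>)"
    by (intro always_eventually allI ballI) (simp add: mult_ac)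
qed

lemma slowly_increasing_representation:
  assumes f: "measurable_near_infinity f" "slowly_increasing f"
  shows "\<exists>a0>0. \<forall>a\<ge>a0. \<exists>v \<eta> \<phi>.
    \<eta> \<in> borel_measurable (lebesgue_on {a..}) \<and> \<phi> \<in> borel_measurable (lebesgue_on {a..}) \<and>
    \<eta> \<in> o[at_top](\<gamma>) \<and> \<phi> \<in> o[at_top](\<gamma>) \<and>
    (\<forall>t. (\<lambda>u. \<phi> u / u) absolutely_integrable_on {a..t}) \<and>
    (\<forall>t\<ge>a. f t = v + \<eta> t + integral {a..t} (\<lambda>u. \<phi> u / u))"
proof -
  have bdd: "\<forall>\<^sub>F t in at_top. \<exists>M. \<forall>x\<in>{1..2}. norm (f (x * t)) \<le> M"
    using slowly_increasing_uniform[OF f, of 1 2 1]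
  proof (rule eventually_mono)
    fix t assume "\<forall>x\<in>{1..2}. \<bar>f (x * t) - f t\<bar> \<le> 1 * \<bar>\<gamma> t\<bar>"
    then have "\<forall>x\<in>{1..2}. norm (f (x * t)) \<le> \<bar>f t\<bar> + \<bar>\<gamma> t\<bar>"
      by (auto dest!: bspec)
    then show "\<exists>M. \<forall>x\<in>{1..2}. norm (f (x * t)) \<le> M" by blast
  qed auto
  obtain a0 where a0: "0 < a0" "\<And>a. a0 \<le> a \<Longrightarrow> f \<in> borel_measurable (lebesgue_on {a..})"
      "\<And>a b. a0 \<le> a \<Longrightarrow> \<exists>M. \<forall>u\<in>{a..b}. norm (f u) \<le> M"
    using locally_bounded_near_infinity[OF f(1) bdd] by blast
  show ?thesis
  proof (rule exI[of _ a0], intro conjI allI impI a0(1))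
    fix a assume a: "a0 \<le> a"
    have fm: "f \<in> borel_measurable (lebesgue_on {a..})" and a_pos: "0 < a"
      using a0(1,2) a by auto
    have int: "(\<lambda>u. f u / u) integrable_on {a..b}" for b
    proof -
      obtain M where "\<forall>u\<in>{a..b}. norm (f u) \<le> M" using a0(3)[OF a] by blast
      then show ?thesis
        by (intro set_lebesgue_integral_eq_integral(1) absolutely_integrable_over_id[OF fm a_pos]) auto
    qed
    define L where "L = (\<lambda>t. integral {a..t} (\<lambda>u. f u / u))"
    \<comment> \<open>With \<open>L\<close> a primitive of \<open>f u / u\<close>, this is the
      average of \<open>f\<close> over \<open>{t..2 * t}\<close>; dividing by \<open>ln 2\<close>,
      the mass of that interval under du / u, normalises it.\<close>
    define F where "F = (\<lambda>t. (L (2 * t) - L t) / ln 2)"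
    define \<phi> where "\<phi> = (\<lambda>t. (f (2 * t) - f t) / ln 2)"
    define \<eta> where "\<eta> = (\<lambda>t. f t - F t)"
    have ln2: "(0::real) < ln 2" by simp
    have f2m: "(\<lambda>u. f (2 * u)) \<in> borel_measurable (lebesgue_on {a..})"
      using measurable_scaling_Ici[OF fm, of 2 a] a_pos by (simp add: mult.commute)
    have \<phi>m: "\<phi> \<in> borel_measurable (lebesgue_on {a..})"
      unfolding \<phi>_def by (intro borel_measurable_divide borel_measurable_diff borel_measurable_const fm f2m)
    have Lc: "continuous_on {a..} L"
      unfolding L_def by (rule continuous_on_integral_Ici[OF int])
    have "continuous_on {a..} F"
      unfolding F_def using ln2 a_pos
      by (intro continuous_intros continuous_on_compose2[OF Lc] Lc) auto
    then have \<eta>m: "\<eta> \<in> borel_measurable (lebesgue_on {a..})"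
      unfolding \<eta>_def
      by (intro borel_measurable_diff fm continuous_imp_measurable_on_sets_lebesgue) auto
    have \<phi>o: "\<phi> \<in> o[at_top](\<gamma>)"
      using f(2) unfolding \<phi>_def slowly_increasing_def by simp
    have "integral {1..2} (\<lambda>y. f t / y) = f t * ln 2" for t
    proof -
      have "((\<lambda>y. f t / y) has_integral f t * ln 2 - f t * ln 1) {1..2}"
        by (intro fundamental_theorem_of_calculus)
          (auto intro!: derivative_eq_intros simp: has_real_derivative_iff_has_vector_derivative[symmetric])
      then show ?thesis by (simp add: integral_unique)
    qed
    then have "(\<lambda>t. L (2 * t) - L t - f t * ln 2) \<in> o[at_top](\<gamma>)"
      using primitive_increment[OF int, where \<Phi> = "\<lambda>y t. f t" and x = 2]
        slowly_increasing_uniform[OF f] by (simp add: L_def)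
    then have "(\<lambda>t. - 1 / ln 2 * (L (2 * t) - L t - f t * ln 2)) \<in> o[at_top](\<gamma>)"
      by simp
    also have "(\<lambda>t. - 1 / ln 2 * (L (2 * t) - L t - f t * ln 2)) = \<eta>"
      using ln2 by (simp add: \<eta>_def F_def fun_eq_iff field_simps)
    finally have \<eta>o: "\<eta> \<in> o[at_top](\<gamma>)" .
    have \<phi>int: "(\<lambda>u. \<phi> u / u) absolutely_integrable_on {a..t}" for t
    proof -
      obtain M where M: "\<forall>u\<in>{a..2 * t}. norm (f u) \<le> M" using a0(3)[OF a] by blast
      have "\<bar>\<phi> u\<bar> \<le> (M + M) / ln 2" if "u \<in> {a..t}" for u
      proof -
        have "\<bar>f u\<bar> \<le> M" "\<bar>f (2 * u)\<bar> \<le> M" using M that a_pos by auto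
        then show ?thesis unfolding \<phi>_def abs_divide by (intro frac_le) auto
      qed
      then show ?thesis by (rule absolutely_integrable_over_id[OF \<phi>m a_pos])
    qed
    \<comment> \<open>Instead of differentiating the average, the substitution
      \<open>u \<mapsto> 2 * u\<close> moves the integral over \<open>{2 * a..2 * t}\<close> back to
      \<open>{a..t}\<close>. Since \<open>L a = 0\<close>, the leftover
      \<open>L (2 * a) / ln 2\<close> is the constant \<open>F a\<close>.\<close>
    have "f t = F a + \<eta> t + integral {a..t} (\<lambda>u. \<phi> u / u)" if t: "a \<le> t" for t
    proof -
      have 1: "L (2 * t) - L (2 * a) = integral {2 * a..2 * t} (\<lambda>u. f u / u)"
        using Henstock_Kurzweil_Integration.integral_combine[OF _ _ int, of "2 * a" "2 * t"] a_pos t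
        by (simp add: L_def)
      have "((\<lambda>u. f u / u) has_integral L (2 * t) - L (2 * a)) {2 * a..2 * t}"
        unfolding 1 using a_pos
        by (intro integrable_integral integrable_on_subinterval[OF int[of "2 * t"]]) auto
      from has_integral_mult_right[OF has_integral_stretch_real[OF this, of 2], of 2]
      have "((\<lambda>u. f (2 * u) / u) has_integral L (2 * t) - L (2 * a)) {a..t}"
        using t by (simp add: image_divide_atLeastAtMost diff_divide_distrib)
      moreover have "((\<lambda>u. f u / u) has_integral L t) {a..t}"
        unfolding L_def by (intro integrable_integral int)
      ultimately have "((\<lambda>u. (f (2 * u) / u - f u / u) / ln 2) has_integral
          (L (2 * t) - L (2 * a) - L t) / ln 2) {a..t}"
        by (intro has_integral_divide has_integral_diff)
      moreover have "(\<lambda>u. (f (2 * u) / u - f u / u) / ln 2) = (\<lambda>u. \<phi> u / u)"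
        by (simp add: \<phi>_def fun_eq_iff diff_divide_distrib mult.commute)
      moreover have "L a = 0" by (simp add: L_def)
      ultimately show ?thesis
        by (simp add: integral_unique \<eta>_def F_def diff_divide_distrib)
    qed
    then show "\<exists>v \<eta> \<phi>.
      \<eta> \<in> borel_measurable (lebesgue_on {a..}) \<and> \<phi> \<in> borel_measurable (lebesgue_on {a..}) \<and>
      \<eta> \<in> o[at_top](\<gamma>) \<and> \<phi> \<in> o[at_top](\<gamma>) \<and>
      (\<forall>t. (\<lambda>u. \<phi> u / u) absolutely_integrable_on {a..t}) \<and>
      (\<forall>t\<ge>a. f t = v + \<eta> t + integral {a..t} (\<lambda>u. \<phi> u / u))"
      using \<eta>m \<phi>m \<eta>o \<phi>o \<phi>int by blast
  qed
qed

text \<open>Values \<open>\<phi> (y * t)\<close> are uniformly small for \<open>y\<close> in compact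
  sets, so \<open>primitive_increment\<close> applies with approximant zero. The formula for
  \<open>f\<close> is asked for only eventually, which leaves room to move the base point.\<close>

lemma slowly_increasing_of_representation:
  assumes \<eta>: "\<eta> \<in> o[at_top](\<gamma>)" and \<phi>: "\<phi> \<in> o[at_top](\<gamma>)"
    and int: "\<And>b. (\<lambda>u. \<phi> u / u) integrable_on {a..b}"
    and f: "\<forall>\<^sub>F t in at_top. f t = v + \<eta> t + integral {a..t} (\<lambda>u. \<phi> u / u)"
  shows "slowly_increasing f"
  unfolding slowly_increasing_def
proof (intro allI impI)
  fix x :: real assume x: "0 < x"
  let ?I = "\<lambda>t. integral {a..t} (\<lambda>u. \<phi> u / u)"
  have zero: "integral S (\<lambda>y. 0 / y) = 0" for S :: "real set"
    unfolding div_0 by (rule integral_0)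
  have "(\<lambda>t. ?I (x * t) - ?I t - (if 1 \<le> x then integral {1..x} (\<lambda>y. 0 / y)
      else - integral {x..1} (\<lambda>y. 0 / y))) \<in> o[at_top](\<gamma>)"
    using smallo_scaled_uniform[OF _ _ _ \<phi>] x
    by (intro primitive_increment[where \<Phi> = "\<lambda>_ _. 0", OF int]) auto
  then have "(\<lambda>t. ?I (x * t) - ?I t) \<in> o[at_top](\<gamma>)"
    unfolding zero minus_zero if_cancel diff_zero .
  then have "(\<lambda>t. (\<eta> (x * t) - \<eta> t) + (?I (x * t) - ?I t)) \<in> o[at_top](\<gamma>)"
    by (rule sum_in_smallo(1)[OF sum_in_smallo(2)[OF smallo_scaled[OF x \<eta>] \<eta>]])
  moreover have "\<forall>\<^sub>F t in at_top. (\<eta> (x * t) - \<eta> t) + (?I (x * t) - ?I t) = f (x * t) - f t"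
  proof -
    have "filterlim (\<lambda>t. x * t) at_top at_top"
      by (rule filterlim_tendsto_pos_mult_at_top[OF tendsto_const x filterlim_ident])
    from filterlim_iff[THEN iffD1, OF this, rule_format, OF f] f
    show ?thesis by eventually_elim simp
  qed
  ultimately show "(\<lambda>t. f (x * t) - f t) \<in> o[at_top](\<gamma>)"
    by (simp only: landau_o.small.in_cong)
qed

end

section \<open>Regularly varying rate vectors\<close>

lemma mat_powr_inverse_mult:
  assumes "0 < y"
  shows "mat_powr (1 / y) B *v (mat_powr y B *v v) = v"
proof -
  have "mat_powr (1 / y) B ** mat_powr y B = mat 1"
    using mat_powr_mult[of "1 / y" y B] assms by (simp add: mat_powr_one)
  then show ?thesis by (simp add: matrix_vector_mul_assoc)
qed

lemma mat_powr_vector_bound: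
  fixes B :: "real^'n^'n"
  assumes "0 < p"
  shows "\<exists>K\<ge>0. \<forall>y\<in>{p..q}. \<forall>v. norm (mat_powr y B *v v) \<le> K * norm v"
proof -
  obtain C where C: "0 \<le> C" "\<And>(M :: real^'n^'n) v. norm (M *v v) \<le> norm M * norm v * C"
    using bounded_bilinear.nonneg_bounded[OF bounded_bilinear_matrix_vector_mult] by metis
  have "compact ((\<lambda>y. mat_powr y B) ` {p..q})"
    using assms by (intro compact_continuous_image continuous_on_mat_powr) auto
  then obtain K where K: "\<And>y. y \<in> {p..q} \<Longrightarrow> norm (mat_powr y B) \<le> K"
    by (force dest!: compact_imp_bounded simp: bounded_iff)
  have "norm (mat_powr y B *v v) \<le> \<bar>K\<bar> * C * norm v" if "y \<in> {p..q}" for y v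
  proof -
    have "norm (mat_powr y B *v v) \<le> norm (mat_powr y B) * (norm v * C)"
      using C(2)[of "mat_powr y B" v] by (simp add: mult.assoc)
    also have "\<dots> \<le> \<bar>K\<bar> * (norm v * C)"
      using order_trans[OF K[OF that] abs_ge_self] C(1) by (intro mult_right_mono) auto
    finally show ?thesis by (simp add: mult_ac)
  qed
  then show ?thesis
    using C(1) by (intro exI[of _ "\<bar>K\<bar> * C"]) auto
qed

text \<open>The map \<open>M \<mapsto> c \<bullet> (M *v w)\<close> is bounded linear and passes
  under the matrix-valued integral. The right side has the shape of the correction term in
  \<open>primitive_increment\<close>.\<close>

lemma grv_h_inner:
  fixes B :: "real^'n^'n"
  assumes "0 < x"
  shows "grv_h B c x \<bullet> w =
    (if 1 \<le> x then integral {1..x} (\<lambda>y. (c \<bullet> (mat_powr y B *v w)) / y)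
     else - integral {x..1} (\<lambda>y. (c \<bullet> (mat_powr y B *v w)) / y))"
proof -
  let ?E = "\<lambda>y. (1 / y) *\<^sub>R mat_powr y B"
  have cont: "continuous_on {p..q} ?E" if "0 < p" for p q
    using that by (intro continuous_intros continuous_on_mat_powr) auto
  have lbint: "(LBINT y=ereal p..ereal q. ?E y) = integral {p..q} ?E" if "0 < p" "p \<le> q" for p q
    using that cont by (intro interval_integral_eq_integral borel_integrable_atLeastAtMost')
  have bl: "bounded_linear (\<lambda>M :: real^'n^'n. c \<bullet> (M *v w))"
    by (intro bounded_linear_inner_right_comp bounded_bilinear.bounded_linear_left[OF bounded_bilinear_matrix_vector_mult])
  have inner: "(c v* integral {p..q} ?E) \<bullet> w = integral {p..q} (\<lambda>y. (c \<bullet> (mat_powr y B *v w)) / y)"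
    if "0 < p" for p q
  proof -
    have "(c v* integral {p..q} ?E) \<bullet> w = integral {p..q} ((\<lambda>M. c \<bullet> (M *v w)) \<circ> ?E)"
      using integral_linear[OF integrable_continuous_real[OF cont[OF that]] bl, of q]
      by (simp add: dot_lmul_matrix)
    also have "(\<lambda>M. c \<bullet> (M *v w)) \<circ> ?E = (\<lambda>y. (c \<bullet> (mat_powr y B *v w)) / y)"
      by (simp add: fun_eq_iff bounded_bilinear.scaleR_left[OF bounded_bilinear_matrix_vector_mult])
    finally show ?thesis .
  qed
  show ?thesis
  proof (cases "1 \<le> x")
    case True
    then show ?thesis
      using lbint[of 1 x] inner[of 1 x] by (simp add: grv_h_def one_ereal_def)
  next
    case False
    then show ?thesis
      using lbint[of x 1] inner[of x 1] assms
      by (simp add: grv_h_def one_ereal_def interval_integral_endpoints_reverse[of "ereal 1" "ereal x"]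
          dot_lmul_matrix bounded_bilinear.minus_left[OF bounded_bilinear_matrix_vector_mult])
  qed
qed

locale regularly_varying_vector =
  fixes B :: "real^('n::{finite,linorder})^('n::{finite,linorder})"
    and g :: "real \<Rightarrow> real^('n::{finite,linorder})"
  assumes index: "index_matrix B" and reg: "regularly_varying B g"
begin

text \<open>By \<open>mat_powr_last_row\<close> the last component of the relation defining regular
  variation involves no other component; dividing it by \<open>\<gamma>\<close> yields the limit of
  the ratio.\<close>

sublocale rate_function "\<lambda>t. g t $ last_ix" "B $ last_ix $ last_ix"
proof
  let ?\<gamma> = "\<lambda>t. g t $ last_ix" and ?\<rho> = "B $ last_ix $ last_ix"
  have "ev_constant_sign ?\<gamma>"
    using reg by (auto simp: regularly_varying_def rate_vector_def)
  then show nz: "\<forall>\<^sub>F t in at_top. ?\<gamma> t \<noteq> 0"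
    unfolding ev_constant_sign_def by (auto elim: eventually_mono)
  obtain t0 where t0: "g \<in> borel_measurable (lebesgue_on {t0..})"
    using reg by (auto simp: regularly_varying_def measurable_near_infinity_def)
  have "(\<lambda>v :: real^('n::{finite,linorder}). v $ last_ix) \<in> borel_measurable borel"
    by (intro borel_measurable_continuous_onI continuous_intros)
  from measurable_compose[OF t0 this] show "measurable_near_infinity ?\<gamma>"
    unfolding measurable_near_infinity_def by blast
  show "((\<lambda>t. ?\<gamma> (x * t) / ?\<gamma> t) \<longlongrightarrow> x powr ?\<rho>) at_top" if x: "0 < x" for x
  proof -
    have "(\<lambda>t. (g (x * t) - mat_powr x B *v g t) $ last_ix) \<in> o[at_top](?\<gamma>)"
      using reg x by (auto simp: regularly_varying_def)
    moreover have "(mat_powr x B *v g t) $ last_ix = x powr ?\<rho> * ?\<gamma> t" for t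
      using index x by (intro mat_powr_last_row) (auto simp: index_matrix_def)
    ultimately have "(\<lambda>t. ?\<gamma> (x * t) - x powr ?\<rho> * ?\<gamma> t) \<in> o[at_top](?\<gamma>)"
      by simp
    from tendsto_add[OF smalloD_tendsto[OF this] tendsto_const[of "x powr ?\<rho>"]]
    have "((\<lambda>t. (?\<gamma> (x * t) - x powr ?\<rho> * ?\<gamma> t) / ?\<gamma> t + x powr ?\<rho>) \<longlongrightarrow> x powr ?\<rho>) at_top"
      by simp
    then show ?thesis
      by (rule Lim_transform_eventually) (use nz in \<open>eventually_elim, simp add: field_simps\<close>)
  qed
qed

text \<open>The error vectors satisfy a cocycle identity twisted by \<open>mat_powr y B\<close>.
  Undoing the twist with the power of \<open>1 / y\<close>, which lies in \<open>{1/2..1}\<close>,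
  costs the constant \<open>K\<close>, and the norms then obey the inequality required for
  uniformity.\<close>

lemma uniform:
  assumes pq: "0 < p" "p \<le> q" and "0 < e"
  shows "\<forall>\<^sub>F t in at_top. \<forall>x\<in>{p..q}. norm (g (x * t) - mat_powr x B *v g t) \<le> e * \<bar>g t $ last_ix\<bar>"
proof -
  define D where "D = (\<lambda>x t. norm (g (x * t) - mat_powr x B *v g t))"
  have "\<exists>K\<ge>0. \<forall>y\<in>{1/2..1}. \<forall>v. norm (mat_powr y B *v v) \<le> K * norm v"
    by (rule mat_powr_vector_bound) simp
  then obtain K where K: "0 \<le> K" "\<And>y v. y \<in> {1/2..1} \<Longrightarrow> norm (mat_powr y B *v v) \<le> K * norm v"
    by blast
  have g_meas: "measurable_near_infinity g"
    using reg by (simp add: regularly_varying_def)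
  have "\<forall>\<^sub>F t in at_top. \<forall>x\<in>{p..q}. \<bar>D x t\<bar> \<le> e * \<bar>g t $ last_ix\<bar>"
  proof (rule uniform_smallo_of_cocycle[OF pq \<open>0 < e\<close>, where C = K])
    show "D x \<in> o[at_top](\<lambda>t. g t $ last_ix)" if x: "0 < x" for x
    proof -
      let ?S = "\<lambda>t. \<Sum>i\<in>UNIV. \<bar>(g (x * t) - mat_powr x B *v g t) $ i\<bar>"
      have "D x \<in> O[at_top](?S)"
        unfolding D_def
        by (intro bigoI[where c = 1] always_eventually allI)
          (auto intro: order_trans[OF norm_le_l1_cart])
      moreover have "?S \<in> o[at_top](\<lambda>t. g t $ last_ix)"
      proof (rule big_sum_in_smallo)
        fix i :: 'n
        have "(\<lambda>t. (g (x * t) - mat_powr x B *v g t) $ i) \<in> o[at_top](\<lambda>t. g t $ last_ix)"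
          using reg x by (auto simp: regularly_varying_def)
        then show "(\<lambda>t. \<bar>(g (x * t) - mat_powr x B *v g t) $ i\<bar>) \<in> o[at_top](\<lambda>t. g t $ last_ix)"
          by simp
      qed
      ultimately show ?thesis by (rule landau_o.big_small_trans)
    qed
    show "\<forall>\<^sub>F t in at_top. (\<lambda>x. D x t) \<in> borel_measurable (lebesgue_on {r..})" if r: "0 < r" for r
      using eventually_measurable_scaled[OF g_meas r]
    proof eventually_elim
      case (elim t)
      have "continuous_on {r..} (\<lambda>x. mat_powr x B *v g t)"
        using r by (intro bounded_bilinear.continuous_on[OF bounded_bilinear_matrix_vector_mult]
            continuous_on_mat_powr continuous_on_const) auto
      then have E: "(\<lambda>x. mat_powr x B *v g t) \<in> borel_measurable (lebesgue_on {r..})"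
        by (intro continuous_imp_measurable_on_sets_lebesgue) auto
      show ?case
        unfolding D_def
        by (intro measurable_compose[OF _ borel_measurable_norm] borel_measurable_diff elim E)
    qed
    show "\<forall>\<^sub>F t in at_top. \<forall>x\<in>{p..q}. \<forall>y\<in>{1..2}. \<bar>D x t\<bar> \<le> K * (\<bar>D (x * y) t\<bar> + \<bar>D y (x * t)\<bar>)"
    proof (intro always_eventually allI ballI)
      fix t x y assume x: "x \<in> {p..q}" and y: "y \<in> {1..2::real}"
      let ?d = "\<lambda>x t. g (x * t) - mat_powr x B *v g t"
      have y': "1 / y \<in> {1/2..1}" using y by (auto simp: field_simps)
      have "mat_powr y B *v ?d x t = ?d (x * y) t - ?d y (x * t)"
        using x y pq mat_powr_mult[of y x B]
        by (simp add: matrix_vector_mult_diff_distrib matrix_vector_mul_assoc mult_ac)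
      then have "?d x t = mat_powr (1 / y) B *v (?d (x * y) t - ?d y (x * t))"
        using mat_powr_inverse_mult[of y B "?d x t"] y by simp
      then have "D x t \<le> K * norm (?d (x * y) t - ?d y (x * t))"
        using K(2)[OF y', of "?d (x * y) t - ?d y (x * t)"] by (simp only: D_def)
      then show "\<bar>D x t\<bar> \<le> K * (\<bar>D (x * y) t\<bar> + \<bar>D y (x * t)\<bar>)"
        using mult_left_mono[OF norm_triangle_ineq4[of "?d (x * y) t" "?d y (x * t)"] K(1)]
        by (simp add: D_def)
    qed
  qed
  then show ?thesis by (simp add: D_def)
qed

lemma locally_bounded:
  "\<exists>a0>0. \<forall>a\<ge>a0. g \<in> borel_measurable (lebesgue_on {a..}) \<and>
    (\<forall>b. \<exists>M. \<forall>u\<in>{a..b}. norm (g u) \<le> M)"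
proof (rule locally_bounded_near_infinity)
  show "measurable_near_infinity g"
    using reg by (simp add: regularly_varying_def)
  have "\<exists>K\<ge>0. \<forall>y\<in>{1..2}. \<forall>v. norm (mat_powr y B *v v) \<le> K * norm v"
    by (rule mat_powr_vector_bound) simp
  then obtain K where K: "\<And>y v. y \<in> {1..2} \<Longrightarrow> norm (mat_powr y B *v v) \<le> K * norm v"
    by blast
  have "\<forall>\<^sub>F t in at_top. \<forall>x\<in>{1..2}. norm (g (x * t) - mat_powr x B *v g t) \<le> 1 * \<bar>g t $ last_ix\<bar>"
    by (rule uniform) auto
  then show "\<forall>\<^sub>F t in at_top. \<exists>M. \<forall>x\<in>{1..2}. norm (g (x * t)) \<le> M"
  proof (rule eventually_mono)
    fix t assume t: "\<forall>x\<in>{1..2}. norm (g (x * t) - mat_powr x B *v g t) \<le> 1 * \<bar>g t $ last_ix\<bar>"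
    have "norm (g (x * t)) \<le> \<bar>g t $ last_ix\<bar> + K * norm (g t)" if x: "x \<in> {1..2}" for x
      using bspec[OF t x] K[OF x, of "g t"] norm_triangle_sub[of "g (x * t)" "mat_powr x B *v g t"]
      by linarith
    then show "\<exists>M. \<forall>x\<in>{1..2}. norm (g (x * t)) \<le> M" by blast
  qed
qed

lemma locally_integrable:
  "\<exists>a0>0. \<forall>a\<ge>a0. \<forall>b. (\<lambda>u. (c \<bullet> g u) / u) absolutely_integrable_on {a..b}"
proof -
  obtain a0 where a0: "0 < a0" "\<And>a. a0 \<le> a \<Longrightarrow> g \<in> borel_measurable (lebesgue_on {a..})"
      "\<And>a b. a0 \<le> a \<Longrightarrow> \<exists>M. \<forall>u\<in>{a..b}. norm (g u) \<le> M"
    using locally_bounded by blast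
  show ?thesis
  proof (rule exI[of _ a0], intro conjI allI impI a0(1))
    fix a b assume a: "a0 \<le> a"
    have m: "(\<lambda>u. c \<bullet> g u) \<in> borel_measurable (lebesgue_on {a..})"
      by (intro borel_measurable_inner borel_measurable_const a0(2) a)
    obtain M where M: "\<forall>u\<in>{a..b}. norm (g u) \<le> M" using a0(3)[OF a] by blast
    have "\<bar>c \<bullet> g u\<bar> \<le> norm c * M" if "u \<in> {a..b}" for u
      using M that by (intro order_trans[OF Cauchy_Schwarz_ineq2] mult_left_mono) auto
    then show "(\<lambda>u. (c \<bullet> g u) / u) absolutely_integrable_on {a..b}"
      using a a0(1) by (intro absolutely_integrable_over_id[OF m]) auto
  qed
qed

lemma primitive_increment_grv_h:
  assumes int: "\<And>b. (\<lambda>u. (c \<bullet> g u) / u) integrable_on {a..b}" and x: "0 < x"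
  shows "(\<lambda>t. integral {a..x * t} (\<lambda>u. (c \<bullet> g u) / u) - integral {a..t} (\<lambda>u. (c \<bullet> g u) / u)
      - grv_h B c x \<bullet> g t) \<in> o[at_top](\<lambda>t. g t $ last_ix)"
  unfolding grv_h_inner[OF x]
proof (rule primitive_increment[OF int _ _ x])
  show "continuous_on {0<..} (\<lambda>y. c \<bullet> (mat_powr y B *v g t))" for t
    by (intro continuous_on_inner continuous_on_const continuous_on_mat_powr
        bounded_bilinear.continuous_on[OF bounded_bilinear_matrix_vector_mult]) auto
  fix p q e :: real assume pq: "0 < p" "p \<le> q" and e: "0 < e"
  \<comment> \<open>Cauchy-Schwarz loses a factor \<open>norm c\<close>; the added 1 avoids a
    division by zero when \<open>c = 0\<close>.\<close>
  define e' where "e' = e / (norm c + 1)"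
  have e': "0 < e'" using e norm_ge_zero[of c] by (simp add: e'_def add_nonneg_pos)
  show "\<forall>\<^sub>F t in at_top. \<forall>y\<in>{p..q}. \<bar>c \<bullet> g (y * t) - c \<bullet> (mat_powr y B *v g t)\<bar>
      \<le> e * \<bar>g t $ last_ix\<bar>"
    using uniform[OF pq e']
  proof eventually_elim
    case (elim t)
    show ?case
    proof
      fix y assume "y \<in> {p..q}"
      then have "norm (g (y * t) - mat_powr y B *v g t) \<le> e' * \<bar>g t $ last_ix\<bar>"
        using elim by blast
      then have "\<bar>c \<bullet> (g (y * t) - mat_powr y B *v g t)\<bar> \<le> (norm c + 1) * (e' * \<bar>g t $ last_ix\<bar>)"
        by (intro order_trans[OF Cauchy_Schwarz_ineq2] mult_mono) auto
      also have "\<dots> = e * \<bar>g t $ last_ix\<bar>"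
        using norm_ge_zero[of c] by (simp add: e'_def add_nonneg_eq_0_iff)
      finally show "\<bar>c \<bullet> g (y * t) - c \<bullet> (mat_powr y B *v g t)\<bar> \<le> e * \<bar>g t $ last_ix\<bar>"
        by (simp add: inner_diff_right)
    qed
  qed
qed

text \<open>By \<open>primitive_increment_grv_h\<close> the primitive itself has index
  \<open>c\<close>, so subtracting it removes the term with \<open>grv_h\<close>. The base point
  \<open>a\<close> stays free because the two directions of the theorem use different ones.\<close>

lemma GRV_iff_slowly_increasing:
  assumes f: "measurable_near_infinity f"
    and int: "\<And>b. (\<lambda>u. (c \<bullet> g u) / u) integrable_on {a..b}"
  shows "GRV B g c f \<longleftrightarrow> slowly_increasing (\<lambda>t. f t - integral {a..t} (\<lambda>u. (c \<bullet> g u) / u))"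
proof -
  let ?I = "\<lambda>t. integral {a..t} (\<lambda>u. (c \<bullet> g u) / u)" and ?o = "o[at_top](\<lambda>t. g t $ last_ix)"
  have "(\<lambda>t. f (x * t) - f t - grv_h B c x \<bullet> g t) \<in> ?o \<longleftrightarrow>
      (\<lambda>t. (f (x * t) - ?I (x * t)) - (f t - ?I t)) \<in> ?o" if x: "0 < x" for x
  proof
    note h = primitive_increment_grv_h[OF int x]
    assume "(\<lambda>t. f (x * t) - f t - grv_h B c x \<bullet> g t) \<in> ?o"
    from sum_in_smallo(2)[OF this h]
    show "(\<lambda>t. (f (x * t) - ?I (x * t)) - (f t - ?I t)) \<in> ?o" by (simp add: algebra_simps)
  next
    note h = primitive_increment_grv_h[OF int x]
    assume "(\<lambda>t. (f (x * t) - ?I (x * t)) - (f t - ?I t)) \<in> ?o"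
    from sum_in_smallo(1)[OF this h]
    show "(\<lambda>t. f (x * t) - f t - grv_h B c x \<bullet> g t) \<in> ?o" by (simp add: algebra_simps)
  qed
  with f show ?thesis
    unfolding GRV_def slowly_increasing_def by blast
qed

end

section \<open>Common base points and the two implications\<close>

theorem theorem4p5:
  fixes B :: "real ^ ('n::{finite, linorder}) ^ ('n::{finite, linorder})"
    and g :: "real \<Rightarrow> real ^ ('n::{finite, linorder})"
    and f :: "real \<Rightarrow> real"
    and c :: "real ^ ('n::{finite, linorder})"
  assumes "index_matrix B"
    and "regularly_varying B g"
    and "measurable_near_infinity f"
  shows "GRV B g c f \<longleftrightarrow>
    (\<exists>a>0. \<exists>v. \<exists>\<eta> \<phi>.
       \<eta> \<in> borel_measurable (lebesgue_on {a..}) \<and>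
       \<phi> \<in> borel_measurable (lebesgue_on {a..}) \<and>
       \<eta> \<in> o[at_top](\<lambda>t. g t $ last_ix) \<and>
       \<phi> \<in> o[at_top](\<lambda>t. g t $ last_ix) \<and>
       (\<forall>t\<ge>a.
          set_integrable lebesgue {a..t} (\<lambda>u. (c \<bullet> g u + \<phi> u) / u) \<and>
          f t = v + \<eta> t + (LINT u:{a..t}|lebesgue. (c \<bullet> g u + \<phi> u) / u)))"
    (is "_ \<longleftrightarrow> ?rep")
proof -
  interpret regularly_varying_vector B g
    by (rule regularly_varying_vector.intro[OF assms(1,2)])
  obtain a1 where a1: "0 < a1"
    "\<And>a b. a1 \<le> a \<Longrightarrow> (\<lambda>u. (c \<bullet> g u) / u) absolutely_integrable_on {a..b}"
    using locally_integrable[of c] by blast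
  have int: "(\<lambda>u. (c \<bullet> g u) / u) integrable_on {a..b}" if "a1 \<le> a" for a b
    by (rule set_lebesgue_integral_eq_integral(1)[OF a1(2)[OF that]])
  show ?thesis
  proof
    assume "GRV B g c f"
    define I where "I = (\<lambda>t. integral {a1..t} (\<lambda>u. (c \<bullet> g u) / u))"
    define F where "F = (\<lambda>t. f t - I t)"
    have slow: "slowly_increasing F"
      using GRV_iff_slowly_increasing[OF assms(3) int[OF order_refl]] \<open>GRV B g c f\<close>
      by (simp add: F_def I_def)
    have "measurable_near_infinity F"
    proof -
      obtain t0 where t0: "f \<in> borel_measurable (lebesgue_on {t0..})"
        using assms(3) by (auto simp: measurable_near_infinity_def)
      have "continuous_on {a1..} I"
        unfolding I_def by (intro continuous_on_integral_Ici int order_refl)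
      then have "I \<in> borel_measurable (lebesgue_on {max t0 a1..})"
        by (intro continuous_imp_measurable_on_sets_lebesgue) (auto elim: continuous_on_subset)
      moreover have "f \<in> borel_measurable (lebesgue_on {max t0 a1..})"
        by (rule measurable_restrict_mono[OF t0]) auto
      ultimately show ?thesis
        unfolding measurable_near_infinity_def F_def by (blast intro: borel_measurable_diff)
    qed
    from slowly_increasing_representation[OF this slow]
    obtain a0 where a0: "\<And>a. a0 \<le> a \<Longrightarrow> \<exists>v \<eta> \<phi>.
      \<eta> \<in> borel_measurable (lebesgue_on {a..}) \<and> \<phi> \<in> borel_measurable (lebesgue_on {a..}) \<and>
      \<eta> \<in> o[at_top](\<lambda>t. g t $ last_ix) \<and> \<phi> \<in> o[at_top](\<lambda>t. g t $ last_ix) \<and>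
      (\<forall>t. (\<lambda>u. \<phi> u / u) absolutely_integrable_on {a..t}) \<and>
      (\<forall>t\<ge>a. F t = v + \<eta> t + integral {a..t} (\<lambda>u. \<phi> u / u))"
      by blast
    define a where "a = max a0 a1"
    have a: "a0 \<le> a" "a1 \<le> a" by (simp_all add: a_def)
    from a0[OF a(1)] obtain v \<eta> \<phi> where rep:
      "\<eta> \<in> borel_measurable (lebesgue_on {a..})" "\<phi> \<in> borel_measurable (lebesgue_on {a..})"
      "\<eta> \<in> o[at_top](\<lambda>t. g t $ last_ix)" "\<phi> \<in> o[at_top](\<lambda>t. g t $ last_ix)"
      and \<phi>int: "\<And>t. (\<lambda>u. \<phi> u / u) absolutely_integrable_on {a..t}"
      and F: "\<And>t. a \<le> t \<Longrightarrow> F t = v + \<eta> t + integral {a..t} (\<lambda>u. \<phi> u / u)"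
      by blast
    have abs: "(\<lambda>u. (c \<bullet> g u + \<phi> u) / u) absolutely_integrable_on {a..t}" for t
      using set_integral_add(1)[OF a1(2)[OF a(2)] \<phi>int, of t] by (simp add: add_divide_distrib)
    \<comment> \<open>\<open>I\<close> starts at \<open>a1\<close> but the representation at the
      possibly larger \<open>a\<close>; the piece in between is the constant
      \<open>I a\<close>.\<close>
    have "f t = (v + I a) + \<eta> t + (LINT u:{a..t}|lebesgue. (c \<bullet> g u + \<phi> u) / u)" if t: "a \<le> t" for t
    proof -
      have "I a + integral {a..t} (\<lambda>u. (c \<bullet> g u) / u) = I t"
        unfolding I_def using a t
        by (intro Henstock_Kurzweil_Integration.integral_combine int) auto
      moreover have "(LINT u:{a..t}|lebesgue. (c \<bullet> g u + \<phi> u) / u)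
          = integral {a..t} (\<lambda>u. (c \<bullet> g u) / u) + integral {a..t} (\<lambda>u. \<phi> u / u)"
        unfolding set_lebesgue_integral_eq_integral(2)[OF abs]
        by (simp add: add_divide_distrib integral_add[OF int[OF a(2)] set_lebesgue_integral_eq_integral(1)[OF \<phi>int]])
      ultimately show ?thesis
        using F[OF t] by (simp add: F_def)
    qed
    then show ?rep
      using rep abs a a1(1) by (intro exI[of _ a] conjI exI[of _ "v + I a"] exI[of _ \<eta>] exI[of _ \<phi>]) auto
  next
    assume ?rep
    then obtain a v \<eta> \<phi> where a: "0 < a"
      and \<eta>: "\<eta> \<in> o[at_top](\<lambda>t. g t $ last_ix)" and \<phi>: "\<phi> \<in> o[at_top](\<lambda>t. g t $ last_ix)"
      and abs: "\<And>t. a \<le> t \<Longrightarrow> (\<lambda>u. (c \<bullet> g u + \<phi> u) / u) absolutely_integrable_on {a..t}"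
      and f: "\<And>t. a \<le> t \<Longrightarrow> f t = v + \<eta> t + (LINT u:{a..t}|lebesgue. (c \<bullet> g u + \<phi> u) / u)"
      by blast
    \<comment> \<open>The given \<open>a\<close> may lie below \<open>a1\<close>, where only the sum
      \<open>c \<bullet> g u + \<phi> u\<close> is known to be integrable over \<open>u\<close>.
      From \<open>a2\<close> on the two summands can be separated, and the integral from
      \<open>a\<close> to \<open>a2\<close> is absorbed into the constant \<open>?w\<close>.\<close>
    define a2 where "a2 = max a a1"
    have a2: "a \<le> a2" "a1 \<le> a2" by (simp_all add: a2_def)
    note full = set_lebesgue_integral_eq_integral[OF abs]
    have full2: "(\<lambda>u. (c \<bullet> g u + \<phi> u) / u) integrable_on {a2..b}" for b
    proof (cases "a2 \<le> b")
      case True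
      then show ?thesis
        using a2 by (intro integrable_on_subinterval[OF full(1)[of b]]) auto
    qed auto
    have \<phi>int: "(\<lambda>u. \<phi> u / u) integrable_on {a2..b}" for b
      using integrable_diff[OF full2 int[OF a2(2)], of b] by (simp add: add_divide_distrib)
    let ?w = "v + integral {a..a2} (\<lambda>u. (c \<bullet> g u + \<phi> u) / u)"
    have "slowly_increasing (\<lambda>t. f t - integral {a2..t} (\<lambda>u. (c \<bullet> g u) / u))"
    proof (rule slowly_increasing_of_representation[OF \<eta> \<phi> \<phi>int, where v = ?w])
      show "\<forall>\<^sub>F t in at_top. f t - integral {a2..t} (\<lambda>u. (c \<bullet> g u) / u)
          = ?w + \<eta> t + integral {a2..t} (\<lambda>u. \<phi> u / u)"
        using eventually_ge_at_top[of a2]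
      proof eventually_elim
        case (elim t)
        have "integral {a..a2} (\<lambda>u. (c \<bullet> g u + \<phi> u) / u) + integral {a2..t} (\<lambda>u. (c \<bullet> g u + \<phi> u) / u)
            = integral {a..t} (\<lambda>u. (c \<bullet> g u + \<phi> u) / u)"
          using elim a2 by (intro Henstock_Kurzweil_Integration.integral_combine full(1)) auto
        moreover have "integral {a2..t} (\<lambda>u. (c \<bullet> g u + \<phi> u) / u)
            = integral {a2..t} (\<lambda>u. (c \<bullet> g u) / u) + integral {a2..t} (\<lambda>u. \<phi> u / u)"
          by (simp add: add_divide_distrib integral_add[OF int[OF a2(2)] \<phi>int])
        ultimately show ?case
          using f[of t] full(2)[of t] elim a2 by simp
      qed
    qed
    then show "GRV B g c f"
      using GRV_iff_slowly_increasing[OF assms(3) int[OF a2(2)]] by simp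
  qed
qed

end
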